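(* Let $(\mathfrak A,\mathfrak M)$ be a Cartan pair with $\mathfrak A$ unital, let $x_0\in X=\widehat{\mathfrak M}$ be a point with trivial isotropy, and let $\pi_0$ be the (irreducible) GNS representation of $\mathfrak A$ associated with the pure state $\rho_0(a)=E(a)(x_0)$, where $E:\mathfrak A\to\mathfrak M=C(X)$ is the faithful conditional expectation. Then the pair $(\pi_0(\mathfrak A),\pi_0(\mathfrak M))$ is a Cartan pair.
   Context: $(\mathfrak A,\mathfrak M)$ is a Cartan pair if $\mathfrak A$ is a separable C$^*$-algebra (here unital), $\mathfrak M$ is a maximal abelian C$^*$-subalgebra of $\mathfrak A$ (containing the unit), $\mathfrak M$ is regular, i.e. the set $\mathcal N$ of normalizers generates $\mathfrak A$ as a C$^*$-algebra, and there is a faithful conditional expectation $E:\mathfrak A\to\mathfrak M$ (it is unique). A normalizer is an element $0\ne n\in\mathfrak A$ with $n^*\mathfrak M n\subset\mathfrak M$ and $n\mathfrak M n^*\subset\mathfrak M$. With $X=\widehat{\mathfrak M}$ the Gelfand space, $\mathfrak M$ is identified with $C(X)$. For $n\in\mathcal N$, $\alpha_n$ denotes the homeomorphism from the open set $\mathrm{dom}(\alpha_n)=\{x\in X: n^*n(x)>0\}$ onto $\{x\in X: nn^*(x)>0\}$ determined by $(n^*hn)(x)=h(\alpha_n(x))\,n^*n(x)$ for $h\in C(X)$. A point $x\in X$ has non-trivial isotropy if there is $n\in\mathcal N$ with $x\in\mathrm{dom}(\alpha_n)$, $\alpha_n(x)=x$ and $E(n)(x)=0$ (equivalently, $\alpha_n(x)=x$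 but $\alpha_n$ is not the identity on any neighborhood of $x$); otherwise $x$ has trivial isotropy. *)

theory Defs
  imports "HOL-Analysis.Analysis"
begin

section \<open>Complex Hilbert spaces\<close>

class complex_vector = real_vector +
  fixes scaleC :: "complex \<Rightarrow> 'a \<Rightarrow> 'a"  (infixr \<open>*\<^sub>C\<close> 75)
  assumes scaleC_add_right: "c *\<^sub>C (x + y) = c *\<^sub>C x + c *\<^sub>C y"
    and scaleC_add_left: "(c + d) *\<^sub>C x = c *\<^sub>C x + d *\<^sub>C x"
    and scaleC_scaleC: "c *\<^sub>C (d *\<^sub>C x) = (c * d) *\<^sub>C x"
    and scaleC_of_real: "complex_of_real r *\<^sub>C x = r *\<^sub>R x"

class complex_normed_vector = complex_vector + real_normed_vector +
  assumes norm_scaleC: "norm (c *\<^sub>C x) = cmod c * norm x"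

text \<open>The inner product is linear in the first and conjugate linear in the second variable.\<close>

class complex_inner = complex_normed_vector +
  fixes cinner :: "'a \<Rightarrow> 'a \<Rightarrow> complex"
  assumes cinner_add_left: "cinner (x + y) z = cinner x z + cinner y z"
    and cinner_scaleC_left: "cinner (c *\<^sub>C x) y = c * cinner x y"
    and cinner_commute: "cinner y x = cnj (cinner x y)"
    and cinner_self: "cinner x x = complex_of_real ((norm x)\<^sup>2)"

class chilbert_space = complex_inner + banach


section \<open>Unital C*-algebras\<close>

class cstar_algebra = complex_normed_vector + real_normed_algebra_1 + banach +
  fixes star :: "'a \<Rightarrow> 'a"  (\<open>_\<^sup>\<star>\<close> [1000] 999)
  assumes mult_scaleC_left: "(c *\<^sub>C x) * y = c *\<^sub>C (x * y)"
    and mult_scaleC_right: "x * (c *\<^sub>C y) = c *\<^sub>C (x * y)"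
    and star_star: "(x\<^sup>\<star>)\<^sup>\<star> = x"
    and star_add: "(x + y)\<^sup>\<star> = x\<^sup>\<star> + y\<^sup>\<star>"
    and star_scaleC: "(c *\<^sub>C x)\<^sup>\<star> = cnj c *\<^sub>C x\<^sup>\<star>"
    and star_mult: "(x * y)\<^sup>\<star> = y\<^sup>\<star> * x\<^sup>\<star>"
    and cstar_identity: "norm (x\<^sup>\<star> * x) = (norm x)\<^sup>2"


section \<open>The C*-algebra of bounded operators on a Hilbert space\<close>

lemma scaleC_zero_left [simp]: "0 *\<^sub>C (x::'a::complex_vector) = 0"
  using scaleC_of_real[of 0 x] by simp

lemma scaleC_zero_right [simp]: "c *\<^sub>C (0::'a::complex_vector) = 0"
  using scaleC_add_right[of c 0 0] by simp

lemma scaleC_one [simp]: "1 *\<^sub>C (x::'a::complex_vector) = x"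
  using scaleC_of_real[of 1 x] by simp

lemma scaleC_minus_right: "c *\<^sub>C (- x::'a::complex_vector) = - (c *\<^sub>C x)"
  using scaleC_add_right[of c x "- x"] by (simp add: eq_neg_iff_add_eq_0 add.commute)

lemma scaleC_diff_right: "c *\<^sub>C (x - y::'a::complex_vector) = c *\<^sub>C x - c *\<^sub>C y"
  using scaleC_add_right[of c x "- y"] by (simp add: scaleC_minus_right)

lemma scaleC_minus1 [simp]: "(-1) *\<^sub>C (x::'a::complex_vector) = - x"
  using scaleC_of_real[of "-1" x] by simp

lemma scaleC_scaleR: "c *\<^sub>C (r *\<^sub>R (x::'a::complex_vector)) = r *\<^sub>R (c *\<^sub>C x)"
  by (simp add: scaleC_of_real[symmetric] scaleC_scaleC mult.commute)

lemma bounded_linear_scaleC: "bounded_linear (\<lambda>x::'a::complex_normed_vector. c *\<^sub>C x)"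
  by (rule bounded_linear_intro[where K = "cmod c"])
     (simp_all add: scaleC_add_right scaleC_scaleR norm_scaleC mult.commute)

lemma cinner_zero_left [simp]: "cinner 0 (x::'a::complex_inner) = 0"
  using cinner_add_left[of 0 0 x] by simp

lemma cinner_zero_right [simp]: "cinner (x::'a::complex_inner) 0 = 0"
  by (subst cinner_commute) simp

lemma cinner_minus_left: "cinner (- x) (y::'a::complex_inner) = - cinner x y"
  using cinner_add_left[of x "- x" y] by (simp add: eq_neg_iff_add_eq_0 add.commute)

lemma cinner_diff_left: "cinner (x - y) (z::'a::complex_inner) = cinner x z - cinner y z"
  using cinner_add_left[of x "- y" z] by (simp add: cinner_minus_left)

lemma cinner_add_right: "cinner (x::'a::complex_inner) (y + z) = cinner x y + cinner x z"
  by (subst (1 2 3) cinner_commute) (simp add: cinner_add_left)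

lemma cinner_diff_right: "cinner (x::'a::complex_inner) (y - z) = cinner x y - cinner x z"
  by (subst (1 2 3) cinner_commute) (simp add: cinner_diff_left)

lemma cinner_scaleC_right: "cinner (x::'a::complex_inner) (c *\<^sub>C y) = cnj c * cinner x y"
  by (subst (1 2) cinner_commute) (simp add: cinner_scaleC_left)

lemma norm_add_sq:
  "(norm (x + y))\<^sup>2 = (norm x)\<^sup>2 + (norm y)\<^sup>2 + 2 * Re (cinner x (y::'a::complex_inner))"
proof -
  have "complex_of_real ((norm (x + y))\<^sup>2) = cinner (x + y) (x + y)"
    by (simp add: cinner_self)
  also have "\<dots> = cinner x x + cinner y y + (cinner x y + cnj (cinner x y))"
    by (simp add: cinner_add_left cinner_add_right cinner_commute[of y x])
  also have "\<dots> = complex_of_real ((norm x)\<^sup>2 + (norm y)\<^sup>2 + 2 * Re (cinner x y))"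
    by (simp add: cinner_self complex_add_cnj)
  finally show ?thesis using of_real_eq_iff by blast
qed

lemma norm_diff_sq:
  "(norm (x - y))\<^sup>2 = (norm x)\<^sup>2 + (norm y)\<^sup>2 - 2 * Re (cinner x (y::'a::complex_inner))"
  using norm_add_sq[of x "- y"] cinner_diff_right[of x 0 y] by simp

lemma cinner_cauchy_schwarz: "cmod (cinner x y) \<le> norm x * norm (y::'a::complex_inner)"
proof (cases "y = 0")
  case False
  define c where "c = cinner x y / complex_of_real ((norm y)\<^sup>2)"
  have ny: "norm y > 0" using False by simp
  have "0 \<le> (norm (x - c *\<^sub>C y))\<^sup>2" by simp
  also have "\<dots> = (norm x)\<^sup>2 + (cmod c)\<^sup>2 * (norm y)\<^sup>2 - 2 * Re (cnj c * cinner x y)"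
    by (simp add: norm_diff_sq norm_scaleC cinner_scaleC_right power_mult_distrib)
  also have "cnj c * cinner x y = complex_of_real ((cmod (cinner x y))\<^sup>2 / (norm y)\<^sup>2)"
    unfolding c_def using complex_norm_square[of "cinner x y"] by (simp add: mult.commute)
  also have "(cmod c)\<^sup>2 * (norm y)\<^sup>2 = (cmod (cinner x y))\<^sup>2 / (norm y)\<^sup>2"
    unfolding c_def using ny by (simp add: norm_divide norm_power norm_mult power2_eq_square)
  finally have "(cmod (cinner x y))\<^sup>2 / (norm y)\<^sup>2 \<le> (norm x)\<^sup>2" by simp
  hence "(cmod (cinner x y))\<^sup>2 \<le> (norm x * norm y)\<^sup>2"
    using ny by (simp add: divide_le_eq power_mult_distrib)
  thus ?thesis by (rule power2_le_imp_le) simp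
qed simp

lemma cinner_ext:
  assumes "\<And>x. cinner x y = cinner x (z::'a::complex_inner)" shows "y = z"
proof -
  have "cinner (y - z) (y - z) = 0" using assms by (simp add: cinner_diff_right)
  thus ?thesis by (simp add: cinner_self)
qed

lemma min_norm_element:
  fixes S :: "'a::chilbert_space set"
  assumes cl: "closed S" and ne: "S \<noteq> {}"
    and mid: "\<And>x y. x \<in> S \<Longrightarrow> y \<in> S \<Longrightarrow> (1/2) *\<^sub>R (x + y) \<in> S"
  shows "\<exists>z\<in>S. \<forall>x\<in>S. norm z \<le> norm x"
proof -
  define d where "d = Inf (norm ` S)"
  have bdd: "bdd_below (norm ` S)" by (rule bdd_belowI[of _ 0]) auto
  have dle: "d \<le> norm x" if "x \<in> S" for x
    unfolding d_def using that bdd by (simp add: cInf_lower)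
  have d0: "0 \<le> d" unfolding d_def using ne by (intro cInf_greatest) auto
  have "\<exists>x\<in>S. norm x < d + 1 / real (Suc n)" for n
  proof -
    have "Inf (norm ` S) < d + 1 / real (Suc n)" unfolding d_def[symmetric] by simp
    thus ?thesis using ne bdd by (subst (asm) cInf_less_iff) auto
  qed
  then obtain u where uS: "\<And>n. u n \<in> S" and un: "\<And>n. norm (u n) < d + 1 / real (Suc n)"
    by metis
  have lim: "(\<lambda>n. norm (u n)) \<longlonglongrightarrow> d"
  proof (rule tendsto_sandwich[where f = "\<lambda>_. d" and h = "\<lambda>n. d + 1 / real (Suc n)"])
    show "(\<lambda>n. d + 1 / real (Suc n)) \<longlonglongrightarrow> d"
      using tendsto_add[OF tendsto_const LIMSEQ_inverse_real_of_nat, of d]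
      by (simp add: inverse_eq_divide)
    show "(\<lambda>_. d) \<longlonglongrightarrow> d" by simp
    show "\<forall>\<^sub>F n in sequentially. d \<le> norm (u n)" using dle uS by simp
    show "\<forall>\<^sub>F n in sequentially. norm (u n) \<le> d + 1 / real (Suc n)"
      using un by (intro always_eventually allI less_imp_le)
  qed
  have par: "(dist x y)\<^sup>2 \<le> 2 * ((norm x)\<^sup>2 - d\<^sup>2) + 2 * ((norm y)\<^sup>2 - d\<^sup>2)"
    if "x \<in> S" "y \<in> S" for x y
  proof -
    have "d \<le> norm ((1/2) *\<^sub>R (x + y))" using dle mid that by blast
    hence "d\<^sup>2 \<le> (norm ((1/2) *\<^sub>R (x + y)))\<^sup>2" using d0 by (rule power_mono)
    hence "4 * d\<^sup>2 \<le> (norm (x + y))\<^sup>2" by (simp add: power2_eq_square)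
    thus ?thesis by (simp add: dist_norm norm_add_sq norm_diff_sq)
  qed
  have "Cauchy u"
  proof (rule metric_CauchyI)
    fix e :: real assume e: "e > 0"
    have "(\<lambda>n. (norm (u n))\<^sup>2 - d\<^sup>2) \<longlonglongrightarrow> d\<^sup>2 - d\<^sup>2" by (intro tendsto_intros lim)
    hence "\<forall>\<^sub>F n in sequentially. (norm (u n))\<^sup>2 - d\<^sup>2 < e\<^sup>2 / 4"
      by (rule order_tendstoD) (use e in simp)
    then obtain N where N: "\<And>n. n \<ge> N \<Longrightarrow> (norm (u n))\<^sup>2 - d\<^sup>2 < e\<^sup>2 / 4"
      by (auto simp: eventually_sequentially)
    have aux: "a < b" if "a \<le> 2 * x + 2 * y" "x < b / 4" "y < b / 4" for a b x y :: real
      using that by linarith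
    have "dist (u m) (u n) < e" if "m \<ge> N" "n \<ge> N" for m n
    proof (rule power2_less_imp_less)
      show "(dist (u m) (u n))\<^sup>2 < e\<^sup>2"
        by (rule aux[OF par[OF uS uS] N[OF that(1)] N[OF that(2)]])
    qed (use e in simp)
    thus "\<exists>N. \<forall>m\<ge>N. \<forall>n\<ge>N. dist (u m) (u n) < e" by blast
  qed
  hence "convergent u" by (rule Cauchy_convergent)
  then obtain z where z: "u \<longlonglongrightarrow> z" by (auto simp: convergent_def)
  have "z \<in> S" using closed_sequentially[OF cl uS z] .
  moreover have "norm z = d" using LIMSEQ_unique[OF tendsto_norm[OF z] lim] .
  ultimately show ?thesis using dle by auto
qed

lemma riesz_representation:
  fixes f :: "'a::chilbert_space \<Rightarrow> complex"
  assumes f: "bounded_linear f" and fC: "\<And>c x. f (c *\<^sub>C x) = c * f x"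
  shows "\<exists>y. \<forall>x. f x = cinner x y"
proof (cases "\<forall>x. f x = 0")
  case True
  thus ?thesis by (intro exI[of _ 0]) simp
next
  case False
  interpret f: bounded_linear f by (fact f)
  define S where "S = {x. f x = 1}"
  from False obtain w where w: "f w \<noteq> 0" by auto
  have ne: "S \<noteq> {}" using w fC[of "1 / f w" w] by (auto simp: S_def)
  have cl: "closed S" unfolding S_def
    by (intro closed_Collect_eq continuous_intros f.continuous_on)
  have mid: "(1/2) *\<^sub>R (x + y) \<in> S" if "x \<in> S" "y \<in> S" for x y
    using that by (simp add: S_def f.scaleR f.add scaleR_conv_of_real)
  obtain z where zS: "z \<in> S" and zmin: "\<And>x. x \<in> S \<Longrightarrow> norm z \<le> norm x"
    using min_norm_element[OF cl ne mid] by blast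
  have fz: "f z = 1" using zS by (simp add: S_def)
  hence nz: "z \<noteq> 0" using f.zero by auto
  have orth: "cinner y z = 0" if y: "f y = 0" for y
  proof (rule ccontr)
    assume a: "cinner y z \<noteq> 0"
    hence ny: "norm y > 0" by auto
    define c where "c = cinner z y / complex_of_real ((norm y)\<^sup>2)"
    have "z - c *\<^sub>C y \<in> S" using y fz by (simp add: S_def f.diff fC)
    hence "(norm z)\<^sup>2 \<le> (norm (z - c *\<^sub>C y))\<^sup>2" using zmin by (intro power_mono) auto
    also have "\<dots> = (norm z)\<^sup>2 + (cmod c)\<^sup>2 * (norm y)\<^sup>2 - 2 * Re (cnj c * cinner z y)"
      by (simp add: norm_diff_sq norm_scaleC cinner_scaleC_right power_mult_distrib)
    also have "cnj c * cinner z y = complex_of_real ((cmod (cinner z y))\<^sup>2 / (norm y)\<^sup>2)"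
      unfolding c_def using complex_norm_square[of "cinner z y"] by (simp add: mult.commute)
    also have "(cmod c)\<^sup>2 * (norm y)\<^sup>2 = (cmod (cinner z y))\<^sup>2 / (norm y)\<^sup>2"
      unfolding c_def using ny by (simp add: norm_divide norm_power norm_mult power2_eq_square)
    finally have "(cmod (cinner z y))\<^sup>2 / (norm y)\<^sup>2 \<le> 0" by simp
    moreover have "cinner z y \<noteq> 0" using a by (subst cinner_commute) simp
    hence "(cmod (cinner z y))\<^sup>2 / (norm y)\<^sup>2 > 0" using ny by simp
    ultimately show False by simp
  qed
  have "f x = cinner x (complex_of_real (1 / (norm z)\<^sup>2) *\<^sub>C z)" for x
  proof -
    have "f (x - f x *\<^sub>C z) = 0" by (simp add: f.diff fC fz)
    from orth[OF this] have "cinner x z = f x * complex_of_real ((norm z)\<^sup>2)"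
      by (simp add: cinner_diff_left cinner_scaleC_left cinner_self)
    thus ?thesis using nz by (simp add: cinner_scaleC_right)
  qed
  thus ?thesis by blast
qed

typedef (overloaded) ('h::complex_normed_vector) bop =
    "{T :: 'h \<Rightarrow>\<^sub>L 'h. \<forall>c x. blinfun_apply T (c *\<^sub>C x) = c *\<^sub>C blinfun_apply T x}"
  by (rule exI[of _ 0]) simp

setup_lifting type_definition_bop

lift_definition bop_apply :: "'h::complex_normed_vector bop \<Rightarrow> 'h \<Rightarrow> 'h" is blinfun_apply .

lemma bop_eqI: "(\<And>x. bop_apply S x = bop_apply T x) \<Longrightarrow> S = T"
  by transfer (rule blinfun_eqI)

lemma bop_apply_scaleC: "bop_apply T (c *\<^sub>C x) = c *\<^sub>C bop_apply T x"
  by transfer simp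

lemma bounded_linear_bop_apply: "bounded_linear (bop_apply T)"
  by transfer (rule blinfun.bounded_linear_right)

instantiation bop :: (complex_normed_vector) complex_normed_vector
begin

lift_definition zero_bop :: "'a bop" is 0 by simp
lift_definition plus_bop :: "'a bop \<Rightarrow> 'a bop \<Rightarrow> 'a bop" is "(+)"
  by (simp add: blinfun.bilinear_simps scaleC_add_right)
lift_definition minus_bop :: "'a bop \<Rightarrow> 'a bop \<Rightarrow> 'a bop" is "(-)"
  by (simp add: blinfun.bilinear_simps scaleC_diff_right)
lift_definition uminus_bop :: "'a bop \<Rightarrow> 'a bop" is uminus
  by (simp add: blinfun.bilinear_simps scaleC_minus_right)
lift_definition scaleR_bop :: "real \<Rightarrow> 'a bop \<Rightarrow> 'a bop" is scaleR
  by (simp add: blinfun.bilinear_simps scaleC_scaleR)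
lift_definition scaleC_bop :: "complex \<Rightarrow> 'a bop \<Rightarrow> 'a bop" is
  "\<lambda>c T. Blinfun (\<lambda>x. c *\<^sub>C blinfun_apply T x)"
  by (subst (1 2) bounded_linear_Blinfun_apply)
     (auto intro: bounded_linear_compose[OF bounded_linear_scaleC blinfun.bounded_linear_right]
       simp: scaleC_scaleC mult.commute)
lift_definition norm_bop :: "'a bop \<Rightarrow> real" is norm .
definition sgn_bop :: "'a bop \<Rightarrow> 'a bop" where "sgn_bop T = scaleR (inverse (norm T)) T"
definition dist_bop :: "'a bop \<Rightarrow> 'a bop \<Rightarrow> real" where "dist_bop S T = norm (S - T)"
definition uniformity_bop :: "('a bop \<times> 'a bop) filter" where
  "uniformity_bop = (INF e\<in>{0 <..}. principal {(S, T). dist S T < e})"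
definition open_bop :: "'a bop set \<Rightarrow> bool" where
  "open_bop U = (\<forall>x\<in>U. \<forall>\<^sub>F (x', y) in uniformity. x' = x \<longrightarrow> y \<in> U)"

lemma bop_apply_add: "bop_apply (S + T) x = bop_apply S x + bop_apply (T :: 'a bop) x"
  by transfer (simp add: blinfun.bilinear_simps)
lemma bop_apply_scaleR: "bop_apply (r *\<^sub>R T) x = r *\<^sub>R bop_apply (T :: 'a bop) x"
  by transfer (simp add: blinfun.bilinear_simps)
lemma bop_apply_scaleC_left: "bop_apply (c *\<^sub>C T) x = c *\<^sub>C bop_apply (T :: 'a bop) x"
  by transfer (simp add: bounded_linear_Blinfun_apply
      bounded_linear_compose[OF bounded_linear_scaleC blinfun.bounded_linear_right])

lemma norm_bop_onorm: "norm T = onorm (bop_apply (T :: 'a bop))"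
  by transfer (simp add: norm_blinfun.rep_eq)

instance
proof
  fix S T U :: "'a bop" and r s :: real and c d :: complex
  show "S + T + U = S + (T + U)" "S + T = T + S" "0 + S = S" "- S + S = 0" "S - T = S + - T"
    by (transfer; simp)+
  show "r *\<^sub>R (S + T) = r *\<^sub>R S + r *\<^sub>R T" "(r + s) *\<^sub>R S = r *\<^sub>R S + s *\<^sub>R S"
    "r *\<^sub>R s *\<^sub>R S = (r * s) *\<^sub>R S" "1 *\<^sub>R S = S"
    by (transfer; simp add: algebra_simps)+
  show "c *\<^sub>C (S + T) = c *\<^sub>C S + c *\<^sub>C T" "(c + d) *\<^sub>C S = c *\<^sub>C S + d *\<^sub>C S"
    "c *\<^sub>C d *\<^sub>C S = (c * d) *\<^sub>C S" "complex_of_real r *\<^sub>C S = r *\<^sub>R S"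
    by (rule bop_eqI; simp add: bop_apply_add bop_apply_scaleR bop_apply_scaleC_left
        scaleC_add_left scaleC_add_right scaleC_scaleC scaleC_of_real)+
  show "sgn S = scaleR (inverse (norm S)) S" by (rule sgn_bop_def)
  show "dist S T = norm (S - T)" by (rule dist_bop_def)
  show "uniformity = (INF e\<in>{0 <..}. principal {(S :: 'a bop, T). dist S T < e})"
    by (rule uniformity_bop_def)
  show "open V = (\<forall>x\<in>V. \<forall>\<^sub>F (x', y) in uniformity. x' = x \<longrightarrow> y \<in> V)" for V :: "'a bop set"
    by (rule open_bop_def)
  show "(norm S = 0) = (S = 0)" "norm (r *\<^sub>R S) = \<bar>r\<bar> * norm S"
    by (transfer; simp)+
  show "norm (S + T) \<le> norm S + norm T" by transfer (rule norm_triangle_ineq)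
  show "norm (c *\<^sub>C S) = cmod c * norm S"
  proof -
    have le: "norm (e *\<^sub>C R) \<le> cmod e * norm R" for e and R :: "'a bop"
      unfolding norm_bop_onorm
    proof (rule onorm_bound)
      fix x
      show "norm (bop_apply (e *\<^sub>C R) x) \<le> cmod e * onorm (bop_apply R) * norm x"
        using mult_left_mono[OF onorm[OF bounded_linear_bop_apply[of R], of x], of "cmod e"]
        by (simp add: bop_apply_scaleC_left norm_scaleC mult.assoc)
    qed (simp add: onorm_pos_le[OF bounded_linear_bop_apply])
    show ?thesis
    proof (cases "c = 0")
      case True
      have "0 \<le> norm (0 *\<^sub>C S)" by transfer simp
      thus ?thesis using True le[of 0 S] by simp
    next
      case False
      have "inverse c *\<^sub>C (c *\<^sub>C S) = S"
        using False by (intro bop_eqI) (simp add: bop_apply_scaleC_left scaleC_scaleC)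
      hence "norm S \<le> cmod (inverse c) * norm (c *\<^sub>C S)"
        using le[of "inverse c" "c *\<^sub>C S"] by simp
      hence "cmod c * norm S \<le> norm (c *\<^sub>C S)"
        using False mult_left_mono[of "norm S" "cmod (inverse c) * norm (c *\<^sub>C S)" "cmod c"]
        by (simp add: norm_inverse mult.assoc[symmetric])
      thus ?thesis using le[of c S] by simp
    qed
  qed
qed

end

instance bop :: (chilbert_space) banach
proof
  fix T :: "nat \<Rightarrow> 'a bop"
  assume "Cauchy T"
  hence "Cauchy (\<lambda>n. Rep_bop (T n))"
    by (simp add: Cauchy_def dist_norm norm_bop.rep_eq minus_bop.rep_eq)
  hence "convergent (\<lambda>n. Rep_bop (T n))" by (rule Cauchy_convergent)
  then obtain L where L: "(\<lambda>n. Rep_bop (T n)) \<longlonglongrightarrow> L"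
    by (auto simp: convergent_def)
  have Lx: "(\<lambda>n. blinfun_apply (Rep_bop (T n)) x) \<longlonglongrightarrow> blinfun_apply L x" for x
    by (intro tendsto_intros L)
  have "blinfun_apply L (c *\<^sub>C x) = c *\<^sub>C blinfun_apply L x" for c x
  proof (rule LIMSEQ_unique[OF Lx])
    show "(\<lambda>n. blinfun_apply (Rep_bop (T n)) (c *\<^sub>C x)) \<longlonglongrightarrow> c *\<^sub>C blinfun_apply L x"
    proof -
      have "blinfun_apply (Rep_bop (T n)) (c *\<^sub>C x) = c *\<^sub>C blinfun_apply (Rep_bop (T n)) x" for n
        using Rep_bop[of "T n"] by simp
      thus ?thesis
        using bounded_linear.tendsto[OF bounded_linear_scaleC Lx, of c x] by simp
    qed
  qed
  hence R: "Rep_bop (Abs_bop L) = L" by (simp add: Abs_bop_inverse)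
  have "T \<longlonglongrightarrow> Abs_bop L"
    using L by (simp add: tendsto_iff dist_norm norm_bop.rep_eq minus_bop.rep_eq R)
  thus "convergent T" by (auto simp: convergent_def)
qed

lemma adjoint_exists:
  fixes T :: "'h::chilbert_space bop"
  shows "\<exists>S. \<forall>x y. cinner (bop_apply T x) y = cinner x (bop_apply S y)"
proof -
  interpret T: bounded_linear "bop_apply T" by (rule bounded_linear_bop_apply)
  have "\<exists>w. \<forall>x. cinner (bop_apply T x) y = cinner x w" for y
  proof (rule riesz_representation)
    show "bounded_linear (\<lambda>x. cinner (bop_apply T x) y)"
    proof (rule bounded_linear_intro)
      fix x
      have "cmod (cinner (bop_apply T x) y) \<le> norm (bop_apply T x) * norm y"
        by (rule cinner_cauchy_schwarz)
      also have "\<dots> \<le> onorm (bop_apply T) * norm x * norm y"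
        by (intro mult_right_mono onorm bounded_linear_bop_apply) simp
      finally show "cmod (cinner (bop_apply T x) y) \<le> norm x * (onorm (bop_apply T) * norm y)"
        by (simp add: mult_ac)
    next
      fix r :: real and x
      show "cinner (bop_apply T (r *\<^sub>R x)) y = r *\<^sub>R cinner (bop_apply T x) y"
        by (simp add: scaleC_of_real[symmetric] bop_apply_scaleC cinner_scaleC_left scaleR_conv_of_real)
    qed (simp add: T.add cinner_add_left)
  qed (simp add: bop_apply_scaleC cinner_scaleC_left)
  then obtain g where g: "\<And>x y. cinner (bop_apply T x) y = cinner x (g y)" by metis
  have gadd: "g (y + z) = g y + g z" for y z
    by (rule cinner_ext) (simp add: g[symmetric] cinner_add_right)
  have gC: "g (c *\<^sub>C y) = c *\<^sub>C g y" for c y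
    by (rule cinner_ext) (simp add: g[symmetric] cinner_scaleC_right)
  have gb: "norm (g y) \<le> norm y * onorm (bop_apply T)" for y
  proof (cases "g y = 0")
    case True thus ?thesis by (simp add: onorm_pos_le bounded_linear_bop_apply)
  next
    case False
    have "(norm (g y))\<^sup>2 = cmod (cinner (bop_apply T (g y)) y)"
      by (simp add: g cinner_self norm_power)
    also have "\<dots> \<le> norm (bop_apply T (g y)) * norm y" by (rule cinner_cauchy_schwarz)
    also have "\<dots> \<le> onorm (bop_apply T) * norm (g y) * norm y"
      by (intro mult_right_mono onorm bounded_linear_bop_apply) simp
    finally show ?thesis using False by (simp add: power2_eq_square mult_ac)
  qed
  have "bounded_linear g"
    using gadd gb gC[of "complex_of_real r" for r]
    by (intro bounded_linear_intro[where K = "onorm (bop_apply T)"])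
       (simp_all add: scaleC_of_real)
  hence "bop_apply (Abs_bop (Blinfun g)) = g"
    by (simp add: bop_apply.rep_eq Abs_bop_inverse bounded_linear_Blinfun_apply gC)
  thus ?thesis using g by metis
qed

lemma norm_bop_apply: "norm (bop_apply T x) \<le> norm T * norm (x::'h::complex_normed_vector)"
  unfolding norm_bop_onorm by (intro onorm bounded_linear_bop_apply)

lemma norm_bop_leI:
  fixes T :: "'h::complex_normed_vector bop"
  assumes "0 \<le> b" "\<And>x. norm (bop_apply T x) \<le> b * norm x" shows "norm T \<le> b"
  unfolding norm_bop_onorm using assms by (intro onorm_bound)

text \<open>\<^class>\<open>perfect_space\<close> says that the Hilbert space is nonzero, i.e. that \<open>1 \<noteq> 0\<close> below.\<close>

instantiation bop :: ("{chilbert_space, perfect_space}") cstar_algebra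
begin

lift_definition one_bop :: "'a bop" is id_blinfun by simp
lift_definition times_bop :: "'a bop \<Rightarrow> 'a bop \<Rightarrow> 'a bop" is "(o\<^sub>L)" by simp
definition star_bop :: "'a bop \<Rightarrow> 'a bop" where
  "star_bop T = (SOME S. \<forall>x y. cinner (bop_apply T x) y = cinner x (bop_apply S y))"

lemma bop_apply_one: "bop_apply (1 :: 'a bop) x = x"
  by transfer simp
lemma bop_apply_mult: "bop_apply (S * T) x = bop_apply S (bop_apply (T :: 'a bop) x)"
  by transfer simp
lemma cinner_star: "cinner (bop_apply T x) y = cinner x (bop_apply ((T :: 'a bop)\<^sup>\<star>) y)"
  using someI_ex[OF adjoint_exists[of T]] unfolding star_bop_def by blast
lemma cinner_star_left: "cinner (bop_apply ((T :: 'a bop)\<^sup>\<star>) x) y = cinner x (bop_apply T y)"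
  by (subst (1 2) cinner_commute) (simp add: cinner_star)

instance
proof
  fix S T U :: "'a bop" and r :: real and c :: complex
  have add: "bop_apply R (x + y) = bop_apply R x + bop_apply R y" for R :: "'a bop" and x y
    using bounded_linear_bop_apply[of R] by (simp add: linear_simps)
  have scR: "bop_apply R (s *\<^sub>R x) = s *\<^sub>R bop_apply R x" for R :: "'a bop" and s x
    using bounded_linear_bop_apply[of R] by (simp add: linear_simps)
  note app = bop_apply_mult bop_apply_one bop_apply_add bop_apply_scaleR bop_apply_scaleC_left
    bop_apply_scaleC add scR
  show "S * T * U = S * (T * U)" "1 * S = S" "S * 1 = S" "(S + T) * U = S * U + T * U"
    "S * (T + U) = S * T + S * U" "r *\<^sub>R S * T = r *\<^sub>R (S * T)" "S * r *\<^sub>R T = r *\<^sub>R (S * T)"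
    "c *\<^sub>C S * T = c *\<^sub>C (S * T)" "S * c *\<^sub>C T = c *\<^sub>C (S * T)"
    by (rule bop_eqI; simp add: app)+
  show n1: "norm (1 :: 'a bop) = 1" by transfer simp
  show "(0 :: 'a bop) \<noteq> 1" using n1 norm_zero by (metis zero_neq_one)
  show mult: "norm (S * T) \<le> norm S * norm T" for S T :: "'a bop"
    by transfer (rule norm_blinfun_compose)
  show "(S\<^sup>\<star>)\<^sup>\<star> = S"
    by (rule bop_eqI, rule cinner_ext) (simp add: cinner_star[symmetric] cinner_star_left)
  show "(S + T)\<^sup>\<star> = S\<^sup>\<star> + T\<^sup>\<star>"
    by (rule bop_eqI, rule cinner_ext)
       (simp add: cinner_star[symmetric] app cinner_add_left cinner_add_right)
  show "(c *\<^sub>C S)\<^sup>\<star> = cnj c *\<^sub>C S\<^sup>\<star>"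
    by (rule bop_eqI, rule cinner_ext)
       (simp add: cinner_star[symmetric] app cinner_scaleC_left cinner_scaleC_right)
  show "(S * T)\<^sup>\<star> = T\<^sup>\<star> * S\<^sup>\<star>"
    by (rule bop_eqI, rule cinner_ext) (simp add: cinner_star[symmetric] app)
  show "norm (S\<^sup>\<star> * S) = (norm S)\<^sup>2"
  proof (rule antisym)
    have ns: "norm (S\<^sup>\<star>) \<le> norm S"
    proof (rule norm_bop_leI)
      fix x
      show "norm (bop_apply (S\<^sup>\<star>) x) \<le> norm S * norm x"
      proof (cases "bop_apply (S\<^sup>\<star>) x = 0")
        case False
        define w where "w = bop_apply (S\<^sup>\<star>) x"
        have "(norm w)\<^sup>2 = cmod (cinner w w)"
          by (simp add: cinner_self norm_power)
        also have "\<dots> = cmod (cinner (bop_apply S w) x)"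
          by (simp add: cinner_star w_def)
        also have "\<dots> \<le> norm (bop_apply S w) * norm x" by (rule cinner_cauchy_schwarz)
        also have "\<dots> \<le> norm S * norm w * norm x"
          by (intro mult_right_mono norm_bop_apply) simp
        finally show ?thesis using False by (simp add: power2_eq_square mult_ac w_def)
      qed simp
    qed simp
    have "norm (S\<^sup>\<star> * S) \<le> norm (S\<^sup>\<star>) * norm S" by (rule mult)
    also have "\<dots> \<le> norm S * norm S" by (intro mult_right_mono ns) simp
    finally show "norm (S\<^sup>\<star> * S) \<le> (norm S)\<^sup>2" by (simp add: power2_eq_square)
    have "norm S \<le> sqrt (norm (S\<^sup>\<star> * S))"
    proof (rule norm_bop_leI)
      fix x
      have "(norm (bop_apply S x))\<^sup>2 = cmod (cinner (bop_apply S x) (bop_apply S x))"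
        by (simp add: cinner_self norm_power)
      also have "\<dots> = cmod (cinner x (bop_apply (S\<^sup>\<star> * S) x))"
        by (simp add: cinner_star bop_apply_mult)
      also have "\<dots> \<le> norm x * norm (bop_apply (S\<^sup>\<star> * S) x)" by (rule cinner_cauchy_schwarz)
      also have "\<dots> \<le> norm x * (norm (S\<^sup>\<star> * S) * norm x)"
        by (intro mult_left_mono norm_bop_apply) simp
      also have "\<dots> = (sqrt (norm (S\<^sup>\<star> * S)) * norm x)\<^sup>2"
        by (simp add: power_mult_distrib power2_eq_square)
      finally show "norm (bop_apply S x) \<le> sqrt (norm (S\<^sup>\<star> * S)) * norm x"
        by (rule power2_le_imp_le) simp
    qed simp
    hence "(norm S)\<^sup>2 \<le> (sqrt (norm (S\<^sup>\<star> * S)))\<^sup>2" by (intro power_mono) simp_all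
    thus "(norm S)\<^sup>2 \<le> norm (S\<^sup>\<star> * S)" by simp
  qed
qed

end


section \<open>Cartan pairs\<close>

definition cstar_subalgebra :: "'a::cstar_algebra set \<Rightarrow> bool" where
  "cstar_subalgebra B \<longleftrightarrow> closed B \<and> 0 \<in> B \<and>
     (\<forall>x\<in>B. \<forall>y\<in>B. x + y \<in> B \<and> x * y \<in> B) \<and>
     (\<forall>c. \<forall>x\<in>B. c *\<^sub>C x \<in> B) \<and> (\<forall>x\<in>B. x\<^sup>\<star> \<in> B)"

definition cstar_generated :: "'a::cstar_algebra set \<Rightarrow> 'a set" where
  "cstar_generated S = \<Inter> {B. cstar_subalgebra B \<and> S \<subseteq> B}"

definition abelian :: "'a::cstar_algebra set \<Rightarrow> bool" where
  "abelian B \<longleftrightarrow> (\<forall>x\<in>B. \<forall>y\<in>B. x * y = y * x)"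

definition maximal_abelian :: "'a::cstar_algebra set \<Rightarrow> 'a set \<Rightarrow> bool" where
  "maximal_abelian A M \<longleftrightarrow> cstar_subalgebra M \<and> M \<subseteq> A \<and> abelian M \<and>
     (\<forall>B. cstar_subalgebra B \<and> B \<subseteq> A \<and> abelian B \<and> M \<subseteq> B \<longrightarrow> B = M)"

definition normalizers :: "'a::cstar_algebra set \<Rightarrow> 'a set \<Rightarrow> 'a set" where
  "normalizers A M = {n \<in> A. n \<noteq> 0 \<and> (\<forall>h\<in>M. n\<^sup>\<star> * h * n \<in> M) \<and> (\<forall>h\<in>M. n * h * n\<^sup>\<star> \<in> M)}"

text \<open>Positive elements of \<open>A\<close> are those of the form \<open>b\<^sup>\<star> * b\<close>. We only use conditional
  expectations onto abelian subalgebras, for which positive maps are completely positive.\<close>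

definition conditional_expectation :: "'a::cstar_algebra set \<Rightarrow> 'a set \<Rightarrow> ('a \<Rightarrow> 'a) \<Rightarrow> bool" where
  "conditional_expectation A M E \<longleftrightarrow>
     (\<forall>a\<in>A. E a \<in> M) \<and>
     (\<forall>a\<in>A. \<forall>b\<in>A. E (a + b) = E a + E b) \<and>
     (\<forall>c. \<forall>a\<in>A. E (c *\<^sub>C a) = c *\<^sub>C E a) \<and>
     (\<forall>a\<in>A. norm (E a) \<le> norm a) \<and>
     (\<forall>a\<in>A. \<exists>b\<in>A. E (a\<^sup>\<star> * a) = b\<^sup>\<star> * b) \<and>
     (\<forall>h\<in>M. E h = h) \<and>
     (\<forall>h\<in>M. \<forall>a\<in>A. E (h * a) = h * E a \<and> E (a * h) = E a * h)"

definition faithful_conditional_expectation ::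
    "'a::cstar_algebra set \<Rightarrow> 'a set \<Rightarrow> ('a \<Rightarrow> 'a) \<Rightarrow> bool" where
  "faithful_conditional_expectation A M E \<longleftrightarrow>
     conditional_expectation A M E \<and> (\<forall>a\<in>A. E (a\<^sup>\<star> * a) = 0 \<longrightarrow> a = 0)"

text \<open>Here \<open>A\<close> is a unital C*-algebra given as a subalgebra of the type \<open>'a\<close> with the same unit.\<close>

definition cartan_pair :: "'a::cstar_algebra set \<Rightarrow> 'a set \<Rightarrow> bool" where
  "cartan_pair A M \<longleftrightarrow>
     cstar_subalgebra A \<and> (\<exists>D. countable D \<and> D \<subseteq> A \<and> A \<subseteq> closure D) \<and>
     maximal_abelian A M \<and> 1 \<in> M \<and>
     cstar_generated (normalizers A M) = A \<and>
     (\<exists>E. faithful_conditional_expectation A M E)"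


section \<open>Gelfand space and isotropy\<close>

text \<open>Characters of \<open>M\<close> are extensional functions, so that equality of points of the Gelfand space
  is equality of functions. Under \<open>M = C(X)\<close>, the value \<open>h(x)\<close> is \<^term>\<open>x h\<close>.\<close>

definition gelfand_space :: "'a::cstar_algebra set \<Rightarrow> ('a \<Rightarrow> complex) set" where
  "gelfand_space M = {x \<in> extensional M.
     (\<forall>h\<in>M. \<forall>k\<in>M. x (h + k) = x h + x k \<and> x (h * k) = x h * x k) \<and>
     (\<forall>c. \<forall>h\<in>M. x (c *\<^sub>C h) = c * x h) \<and> (\<exists>h\<in>M. x h \<noteq> 0)}"

text \<open>\<open>n\<^sup>\<star> * n\<close> is positive, so its value at \<open>x\<close> is real.\<close>

definition alpha_dom :: "'a::cstar_algebra set \<Rightarrow> 'a \<Rightarrow> ('a \<Rightarrow> complex) set" where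
  "alpha_dom M n = {x \<in> gelfand_space M. Re (x (n\<^sup>\<star> * n)) > 0}"

text \<open>The point \<open>alpha M n x\<close> is the character solving
  \<open>x (n\<^sup>\<star> * h * n) = alpha M n x h * x (n\<^sup>\<star> * n)\<close> for all \<open>h \<in> M\<close>.\<close>

definition alpha :: "'a::cstar_algebra set \<Rightarrow> 'a \<Rightarrow> ('a \<Rightarrow> complex) \<Rightarrow> ('a \<Rightarrow> complex)" where
  "alpha M n x = (\<lambda>h\<in>M. x (n\<^sup>\<star> * h * n) / x (n\<^sup>\<star> * n))"

lemma alpha_unique:
  assumes M: "cstar_subalgebra M" "abelian M" "1 \<in> M"
    and n: "n \<in> normalizers A M" and x: "x \<in> alpha_dom M n"
  shows "y \<in> gelfand_space M \<and> (\<forall>h\<in>M. x (n\<^sup>\<star> * h * n) = y h * x (n\<^sup>\<star> * n)) \<longleftrightarrow> y = alpha M n x"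
proof
  have xnz: "x (n\<^sup>\<star> * n) \<noteq> 0" and xg: "x \<in> gelfand_space M"
    using x by (auto simp: alpha_dom_def)
  {
    assume y: "y \<in> gelfand_space M \<and> (\<forall>h\<in>M. x (n\<^sup>\<star> * h * n) = y h * x (n\<^sup>\<star> * n))"
    show "y = alpha M n x"
    proof
      fix h
      show "y h = alpha M n x h"
        using y xnz by (cases "h \<in> M") (auto simp: alpha_def gelfand_space_def extensional_def)
    qed
  }
  assume y: "y = alpha M n x"
  have xadd: "x (h + k) = x h + x k" and xmult: "x (h * k) = x h * x k" if "h \<in> M" "k \<in> M" for h k
    using xg that by (auto simp: gelfand_space_def)
  have xC: "x (c *\<^sub>C h) = c * x h" if "h \<in> M" for c h
    using xg that by (auto simp: gelfand_space_def)
  have nM: "n\<^sup>\<star> * h * n \<in> M" "n * h * n\<^sup>\<star> \<in> M" if "h \<in> M" for h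
    using n that by (auto simp: normalizers_def)
  have n1: "n\<^sup>\<star> * n \<in> M" "n * n\<^sup>\<star> \<in> M" using nM[OF M(3)] by simp_all
  have cl: "h + k \<in> M" "h * k \<in> M" "c *\<^sub>C h \<in> M" if "h \<in> M" "k \<in> M" for h k c
    using M(1) that by (auto simp: cstar_subalgebra_def)
  have mul: "x (n\<^sup>\<star> * (h * k) * n) * x (n\<^sup>\<star> * n) = x (n\<^sup>\<star> * h * n) * x (n\<^sup>\<star> * k * n)"
    if hk: "h \<in> M" "k \<in> M" for h k
  proof -
    have "k * (n * n\<^sup>\<star>) = (n * n\<^sup>\<star>) * k" using M(2) n1(2) hk(2) by (auto simp: abelian_def)
    have "(n\<^sup>\<star> * (h * k) * n) * (n\<^sup>\<star> * n) = n\<^sup>\<star> * h * (k * (n * n\<^sup>\<star>)) * n"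
      by (simp only: mult.assoc)
    also have "\<dots> = n\<^sup>\<star> * h * ((n * n\<^sup>\<star>) * k) * n"
      by (simp only: \<open>k * (n * n\<^sup>\<star>) = (n * n\<^sup>\<star>) * k\<close>)
    also have "\<dots> = (n\<^sup>\<star> * h * n) * (n\<^sup>\<star> * k * n)"
      by (simp only: mult.assoc)
    finally have "(n\<^sup>\<star> * (h * k) * n) * (n\<^sup>\<star> * n) = (n\<^sup>\<star> * h * n) * (n\<^sup>\<star> * k * n)" .
    thus ?thesis using xmult[OF nM(1)[OF cl(2)[OF hk]] n1(1)] xmult[OF nM(1)[OF hk(1)] nM(1)[OF hk(2)]]
      by simp
  qed
  have "\<forall>h\<in>M. x (n\<^sup>\<star> * h * n) = y h * x (n\<^sup>\<star> * n)"
    using xnz by (simp add: y alpha_def)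
  moreover have "y \<in> gelfand_space M"
    unfolding gelfand_space_def
  proof (intro CollectI conjI ballI allI)
    show "y \<in> extensional M" by (simp add: y alpha_def)
    show "\<exists>h\<in>M. y h \<noteq> 0" using M(3) xnz by (intro bexI[of _ 1]) (simp_all add: y alpha_def)
    fix h k assume hk: "h \<in> M" "k \<in> M"
    show "y (h + k) = y h + y k"
      using hk cl nM by (simp add: y alpha_def distrib_left distrib_right xadd add_divide_distrib)
    show "y (h * k) = y h * y k"
      using hk cl mul[OF hk] xnz by (simp add: y alpha_def field_simps)
  next
    fix c h assume h: "h \<in> M"
    show "y (c *\<^sub>C h) = c * y h"
      using h cl nM by (simp add: y alpha_def mult_scaleC_left mult_scaleC_right xC)
  qed
  ultimately show "y \<in> gelfand_space M \<and> (\<forall>h\<in>M. x (n\<^sup>\<star> * h * n) = y h * x (n\<^sup>\<star> * n))" by blast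
qed

definition nontrivial_isotropy ::
    "'a::cstar_algebra set \<Rightarrow> 'a set \<Rightarrow> ('a \<Rightarrow> 'a) \<Rightarrow> ('a \<Rightarrow> complex) \<Rightarrow> bool" where
  "nontrivial_isotropy A M E x \<longleftrightarrow>
     (\<exists>n\<in>normalizers A M. x \<in> alpha_dom M n \<and> alpha M n x = x \<and> x (E n) = 0)"


section \<open>GNS representations\<close>

definition star_representation ::
    "('a::cstar_algebra \<Rightarrow> 'h::{chilbert_space, perfect_space} bop) \<Rightarrow> bool" where
  "star_representation \<pi> \<longleftrightarrow>
     (\<forall>a b. \<pi> (a + b) = \<pi> a + \<pi> b \<and> \<pi> (a * b) = \<pi> a * \<pi> b) \<and>
     (\<forall>c a. \<pi> (c *\<^sub>C a) = c *\<^sub>C \<pi> a) \<and> (\<forall>a. \<pi> (a\<^sup>\<star>) = (\<pi> a)\<^sup>\<star>)"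

text \<open>The GNS representation of a state \<open>\<rho>\<close> is determined, up to unitary equivalence, as the
  representation having a cyclic vector \<open>\<xi>\<close> with vector state \<open>\<rho>\<close>. Its Hilbert space is nonzero
  because \<open>\<rho> 1 = 1\<close>.\<close>

definition gns_representation ::
    "('a::cstar_algebra \<Rightarrow> complex) \<Rightarrow> ('a \<Rightarrow> 'h::{chilbert_space, perfect_space} bop) \<Rightarrow> bool" where
  "gns_representation \<rho> \<pi> \<longleftrightarrow> star_representation \<pi> \<and>
     (\<exists>\<xi>. closure (range (\<lambda>a. bop_apply (\<pi> a) \<xi>)) = UNIV \<and>
          (\<forall>a. cinner (bop_apply (\<pi> a) \<xi>) \<xi> = \<rho> a))"

end

theory Submission
  imports Defs
begin

text \<open>
  For a normalizer \<open>n\<close> with \<open>\<pi> n \<xi> \<noteq> 0\<close> the vector \<open>\<pi> n \<xi>\<close> is a joint eigenvector of \<open>\<pi> M\<close>, and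
  its eigenvalues are given by the character \<open>\<alpha>\<^sub>n(x\<^sub>0)\<close>: the norm of \<open>\<pi> h (\<pi> n \<xi>)\<close>
  is computed from \<open>n\<^sup>\<star> h\<^sup>\<star> h n \<in> M\<close> at \<open>x\<^sub>0\<close> (\<open>gns_vector_eigenvector\<close>). These vectors span a dense
  subspace, because the normalizers do so in the algebra. If \<open>n\<close> and \<open>m\<close> lead to the same
  character, then \<open>m\<^sup>\<star> n\<close> is a normalizer fixing \<open>x\<^sub>0\<close>, so trivial isotropy gives
  \<open>E(m\<^sup>\<star> n)(x\<^sub>0) \<noteq> 0\<close>, and this forces \<open>\<pi> n \<xi>\<close> and \<open>\<pi> m \<xi>\<close> to be proportional
  (\<open>eigenvector_unique\<close>). Thus the Hilbert space is \<open>l\<^sup>2\<close> of the orbit of \<open>x\<^sub>0\<close> and \<open>\<pi> M\<close>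
  consists of diagonal operators whose entries separate the points of the orbit.

  Consequently an operator commuting with \<open>\<pi> M\<close> is diagonal, hence zero if its diagonal is zero
  (\<open>commuting_zero\<close>). The identity \<open>E(n\<^sup>\<star> a n) = n\<^sup>\<star> E(a) n\<close> (\<open>E_covariant\<close>) says that \<open>\<pi> a\<close> and
  \<open>\<pi> (E a)\<close> have the same diagonal. So \<open>\<pi> a = \<pi> (E a)\<close> whenever \<open>\<pi> a\<close> commutes with \<open>\<pi> M\<close>, which is
  maximality of \<open>\<pi> M\<close>, and taking the diagonal is a well defined map \<open>\<pi> a \<mapsto> \<pi> (E a)\<close>. It is faithful,
  since the diagonal of \<open>\<pi> (a\<^sup>\<star> a)\<close> consists of the squared lengths of the images of the
  eigenvectors. Separability and regularity pass to the image.

  Both \<open>E_covariant\<close> and \<open>eigenvector_unique\<close> rest on one identity in \<open>M\<close>: for a normalizer \<open>m\<close>,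
  \<open>E(m)\<^sup>\<star> m = E(m)\<^sup>\<star> E(m)\<close> (\<open>E_normalizer_absorb\<close>). It expresses that \<open>m\<close> agrees with \<open>E(m)\<close> where
  \<open>E(m)\<close> does not vanish. Its proof, and that of \<open>E_covariant\<close>, compute with elements of the
  algebra and do not use points of the Gelfand space.

  That the image of a representation is closed follows from a bounded lifting: for self-adjoint
  \<open>a\<close> the element \<open>b = a (1 + a\<^sup>2)\<^sup>-\<^sup>1\<close> has norm at most \<open>1\<close> however large \<open>a\<close> is, while \<open>\<pi> b\<close> is close to
  \<open>\<pi> a\<close> if \<open>\<pi> a\<close> is small; scaling and iterating this yields preimages whose norms are controlled by
  the norms of their images (\<open>bounded_lift\<close>).
\<close>

section \<open>Self-adjoint elements of C*-algebras\<close>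

lemma star_zero [simp]: "(0::'a::cstar_algebra)\<^sup>\<star> = 0"
  using star_add[of "0::'a" 0] by simp

lemma star_minus: "(- x::'a::cstar_algebra)\<^sup>\<star> = - x\<^sup>\<star>"
  using star_add[of x "- x"] by (simp add: eq_neg_iff_add_eq_0 add.commute)

lemma star_diff: "(x - y::'a::cstar_algebra)\<^sup>\<star> = x\<^sup>\<star> - y\<^sup>\<star>"
  using star_add[of x "- y"] by (simp add: star_minus)

lemma star_one [simp]: "(1::'a::cstar_algebra)\<^sup>\<star> = 1"
  using star_mult[of "1\<^sup>\<star>" "1::'a"] by (simp add: star_star)

lemma star_scaleR: "(r *\<^sub>R x::'a::cstar_algebra)\<^sup>\<star> = r *\<^sub>R x\<^sup>\<star>"
  using star_scaleC[of "complex_of_real r" x] by (simp add: scaleC_of_real)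

lemma norm_star [simp]: "norm (x\<^sup>\<star>) = norm (x::'a::cstar_algebra)"
proof -
  have le: "norm y \<le> norm (y\<^sup>\<star>)" for y :: 'a
  proof (cases "y = 0")
    case False
    have "norm y * norm y \<le> norm (y\<^sup>\<star>) * norm y"
      using norm_mult_ineq[of "y\<^sup>\<star>" y] cstar_identity[of y] by (simp add: power2_eq_square)
    thus ?thesis using False by simp
  qed simp
  show ?thesis using le[of x] le[of "x\<^sup>\<star>"] by (simp add: star_star)
qed

lemma bounded_linear_star: "bounded_linear (star :: 'a::cstar_algebra \<Rightarrow> 'a)"
  by (rule bounded_linear_intro[where K = 1]) (simp_all add: star_add star_scaleR)

lemma star_mult_self_eq_0 [simp]: "x\<^sup>\<star> * x = 0 \<longleftrightarrow> x = (0::'a::cstar_algebra)"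
  using cstar_identity[of x] by auto

lemma mult_star_self_eq_0 [simp]: "x * x\<^sup>\<star> = 0 \<longleftrightarrow> x = (0::'a::cstar_algebra)"
  using star_mult_self_eq_0[of "x\<^sup>\<star>"] by (metis star_star star_zero)

lemma scaleC_cancel: "c *\<^sub>C x = c *\<^sub>C y \<Longrightarrow> c \<noteq> 0 \<Longrightarrow> x = (y::'a::complex_vector)"
  by (metis scaleC_scaleC left_inverse scaleC_one)

lemma scaleC_minus_left: "(- c) *\<^sub>C x = - (c *\<^sub>C (x::'a::complex_vector))"
  using scaleC_scaleC[of "-1" c x] by simp

definition hermitian_part :: "'a::cstar_algebra \<Rightarrow> 'a" where
  "hermitian_part a = (1 / 2) *\<^sub>R (a + a\<^sup>\<star>)"

lemma hermitian_part_star: "(hermitian_part a)\<^sup>\<star> = hermitian_part a"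
  by (simp add: hermitian_part_def star_scaleR star_add star_star add.commute)

lemma cartesian_decomposition:
  "a = hermitian_part a + \<i> *\<^sub>C hermitian_part (- \<i> *\<^sub>C a)"
proof -
  have "\<i> *\<^sub>C hermitian_part (- \<i> *\<^sub>C a) = (1 / 2) *\<^sub>R (a - a\<^sup>\<star>)"
    by (simp add: hermitian_part_def scaleC_scaleR scaleC_add_right scaleC_scaleC star_scaleC)
  thus ?thesis
    by (simp add: hermitian_part_def scaleR_add_right scaleR_diff_right) (simp flip: scaleR_add_left)
qed

lemma norm_hermitian_part: "norm (hermitian_part a) \<le> norm a"
  using norm_triangle_ineq[of a "a\<^sup>\<star>"] by (simp add: hermitian_part_def)

lemma neumann_inverse:
  fixes x :: "'a::{real_normed_algebra_1, banach}"
  assumes "norm x < 1"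
  shows "\<exists>y. (1 - x) * y = 1 \<and> y * (1 - x) = 1"
proof -
  have s: "summable (\<lambda>n. x ^ n)" using assms by (rule complete_algebra_summable_geometric)
  let ?S = "\<Sum>n. x ^ n"
  have shift: "?S = 1 + (\<Sum>n. x ^ Suc n)"
    using suminf_split_head[OF s] by simp
  have "(\<Sum>n. x ^ Suc n) = x * ?S" using suminf_mult[OF s, of x] by simp
  moreover have "(\<Sum>n. x ^ Suc n) = ?S * x"
    using suminf_mult2[OF s, of x] by (simp add: power_commutes)
  ultimately have "(1 - x) * ?S = 1" "?S * (1 - x) = 1"
    using shift by (simp_all add: algebra_simps)
  thus ?thesis by blast
qed

text \<open>The spectrum of a self-adjoint element is real. With \<open>z = t - \<i> a\<close> one has \<open>1 + \<i> a = (1 + t) - z\<close>, and the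
C*-identity gives \<open>\<parallel>z\<parallel>\<^sup>2 \<le> t\<^sup>2 + \<parallel>a\<parallel>\<^sup>2\<close>, which is smaller than \<open>(1 + t)\<^sup>2\<close> for large \<open>t\<close>; then the
Neumann series applies.\<close>
lemma selfadjoint_inverse:
  fixes a :: "'a::cstar_algebra"
  assumes a: "a\<^sup>\<star> = a"
  shows "\<exists>p. (1 + \<i> *\<^sub>C a) * p = 1 \<and> p * (1 + \<i> *\<^sub>C a) = 1"
proof -
  define t where "t = (norm a)\<^sup>2"
  have t: "t \<ge> 0" by (simp add: t_def)
  define z where "z = t *\<^sub>R 1 - \<i> *\<^sub>C a"
  have zz: "z\<^sup>\<star> * z = (t\<^sup>2) *\<^sub>R 1 + a * a"
    by (simp add: z_def star_diff star_scaleR star_scaleC a scaleC_minus_left algebra_simps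
        mult_scaleC_left mult_scaleC_right scaleC_scaleC scaleC_scaleR power2_eq_square
        scaleC_add_right scaleC_diff_right)
  have "(norm z)\<^sup>2 = norm ((t\<^sup>2) *\<^sub>R 1 + a * a)" using cstar_identity[of z] zz by simp
  also have "\<dots> \<le> norm ((t\<^sup>2) *\<^sub>R (1::'a)) + norm (a * a)" by (rule norm_triangle_ineq)
  also have "\<dots> \<le> t\<^sup>2 + t" using norm_mult_ineq[of a a] by (simp add: t_def power2_eq_square)
  also have "\<dots> < (1 + t)\<^sup>2" using t by (simp add: power2_eq_square algebra_simps)
  finally have zlt: "norm z < 1 + t" using t by (simp add: power2_less_imp_less)
  have "norm (inverse (1 + t) *\<^sub>R z) < 1" using zlt t by (simp add: field_simps)
  then obtain y where y: "(1 - inverse (1 + t) *\<^sub>R z) * y = 1" "y * (1 - inverse (1 + t) *\<^sub>R z) = 1"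
    using neumann_inverse by blast
  have "(1 + t) *\<^sub>R (1 - inverse (1 + t) *\<^sub>R z) = (1 + t) *\<^sub>R 1 - z"
    using t by (simp add: scaleR_diff_right)
  hence eq: "1 + \<i> *\<^sub>C a = (1 + t) *\<^sub>R (1 - inverse (1 + t) *\<^sub>R z)"
    by (simp add: z_def scaleR_add_left)
  show ?thesis
    by (rule exI[of _ "inverse (1 + t) *\<^sub>R y"], unfold eq) (use t y in simp)
qed

text \<open>Here \<open>b = a (1 + a\<^sup>2)\<^sup>-\<^sup>1\<close>. With \<open>p = (1 + \<i> a)\<^sup>-\<^sup>1\<close> the Cayley transform \<open>u = 2 p - 1\<close> is unitary, so
\<open>\<parallel>p\<parallel> \<le> 1\<close>, and \<open>b\<close> is a multiple of the imaginary part of \<open>p\<close>. It replaces continuous functional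
calculus below: truncating an element only requires some bounded function that is close to the
identity near \<open>0\<close>.\<close>
lemma selfadjoint_bounded_transform:
  fixes a :: "'a::cstar_algebra"
  assumes a: "a\<^sup>\<star> = a"
  shows "\<exists>b. norm b \<le> 1 \<and> b * (1 + a * a) = a"
proof -
  define s where "s = 1 + \<i> *\<^sub>C a"
  obtain p where p: "s * p = 1" "p * s = 1" using selfadjoint_inverse[OF a] s_def by blast
  have ss: "s\<^sup>\<star> = 1 - \<i> *\<^sub>C a"
    by (simp add: s_def star_add star_scaleC a scaleC_minus_left)
  have comm: "s\<^sup>\<star> * s = s * s\<^sup>\<star>" "s * s\<^sup>\<star> = 1 + a * a"
    unfolding ss by (simp_all add: s_def algebra_simps mult_scaleC_left mult_scaleC_right scaleC_scaleC
        scaleC_add_right scaleC_diff_right)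
  have p': "s\<^sup>\<star> * p\<^sup>\<star> = 1" "p\<^sup>\<star> * s\<^sup>\<star> = 1"
    using arg_cong[OF p(1), of star] arg_cong[OF p(2), of star] by (simp_all add: star_mult)
  define u where "u = p * s\<^sup>\<star>"
  have "u * u\<^sup>\<star> = p * (s\<^sup>\<star> * s) * p\<^sup>\<star>" by (simp add: u_def star_mult star_star mult.assoc)
  also have "\<dots> = (p * s) * (s\<^sup>\<star> * p\<^sup>\<star>)" by (simp only: comm(1) mult.assoc)
  finally have "(norm u)\<^sup>2 = 1" using cstar_identity[of "u\<^sup>\<star>"] p p' by (simp add: star_star)
  hence nu: "norm u = 1" by (simp add: power2_eq_1_iff) (metis norm_ge_zero not_one_le_zero neg_0_le_iff_le)
  have "u + 1 = p * (s\<^sup>\<star> + s)" by (simp add: u_def p distrib_left)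
  also have "s\<^sup>\<star> + s = 2 *\<^sub>R 1" unfolding ss by (simp add: s_def scaleR_2)
  finally have "2 *\<^sub>R p = u + 1" by simp
  hence "2 * norm p \<le> 2" using norm_triangle_ineq[of u 1] nu by (metis norm_scaleR abs_numeral norm_one one_add_one)
  hence np: "norm p \<le> 1" by simp
  define b where "b = (\<i>/2) *\<^sub>C (p - p\<^sup>\<star>)"
  have "norm b \<le> (norm p + norm (p\<^sup>\<star>)) / 2"
    using norm_triangle_ineq4[of p "p\<^sup>\<star>"] by (simp add: b_def norm_scaleC norm_divide)
  hence "norm b \<le> 1" using np by simp
  moreover have "b * (1 + a * a) = a"
  proof -
    have "(p - p\<^sup>\<star>) * (s * s\<^sup>\<star>) = (p * s) * s\<^sup>\<star> - p\<^sup>\<star> * (s\<^sup>\<star> * s)"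
      by (simp only: comm(1) left_diff_distrib mult.assoc)
    also have "\<dots> = s\<^sup>\<star> - s" using p p' by (simp add: mult.assoc[symmetric])
    also have "\<dots> = (- 2 * \<i>) *\<^sub>C a"
      unfolding ss using scaleC_add_left[of \<i> \<i> a] by (simp add: s_def scaleC_minus_left)
    finally show ?thesis by (simp add: b_def mult_scaleC_left comm scaleC_scaleC)
  qed
  ultimately show ?thesis by blast
qed

text \<open>Removes a constant \<open>K\<close> from a norm estimate that survives repeated squaring.\<close>
lemma power_two_power_le_imp_le:
  fixes x r K :: real
  assumes r: "0 \<le> r" and le: "\<And>j. x ^ (2 ^ j) \<le> K * r ^ (2 ^ j)"
  shows "x \<le> r"
proof (rule ccontr)
  assume "\<not> x \<le> r"
  hence rx: "r < x" by simp
  show False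
  proof (cases "r = 0")
    case True
    thus False using le[of 0] rx by simp
  next
    case False
    hence r0: "r > 0" using r by simp
    have q: "x / r > 1" using rx r0 by simp
    obtain n where n: "K < (x / r) ^ n" using real_arch_pow[OF q] by blast
    have "(x / r) ^ n \<le> (x / r) ^ (2 ^ n)" using q by (intro power_increasing) (auto intro: less_imp_le)
    also have "\<dots> \<le> K" using le[of n] r0 by (simp add: power_divide divide_le_eq)
    finally show False using n by simp
  qed
qed

section \<open>Representations are contractive and have closed range\<close>

lemma bop_apply_diff: "bop_apply (S - T) x = bop_apply S x - bop_apply T x"
  using bop_apply_add[of "S - T" T x] by simp

lemma bop_apply_zero: "bop_apply 0 x = 0"
  using bop_apply_diff[of 0 0 x] by simp

text \<open>The iteration behind the open mapping theorem: an approximate preimage is found for \<open>b\<close>, then for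
the error that remains, and so on; the errors decay like \<open>q\<^sup>n\<close>, so the corrections form an absolutely
convergent series.\<close>
lemma closed_range_lifting:
  fixes f :: "'a::banach \<Rightarrow> 'b::real_normed_vector"
  assumes f: "bounded_linear f" and K: "0 \<le> K" and q: "0 \<le> q" "q < 1"
    and appr: "\<And>b. b \<in> closure (range f) \<Longrightarrow> \<exists>a. norm a \<le> K * norm b \<and> norm (b - f a) \<le> q * norm b"
    and b: "b \<in> closure (range f)"
  shows "\<exists>a. f a = b \<and> norm a \<le> K / (1 - q) * norm b"
proof -
  interpret f: bounded_linear f by fact
  define g where "g c = (SOME a. norm a \<le> K * norm c \<and> norm (c - f a) \<le> q * norm c)" for c
  have g: "norm (g c) \<le> K * norm c" "norm (c - f (g c)) \<le> q * norm c" if "c \<in> closure (range f)" for c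
    using someI_ex[OF appr[OF that]] by (auto simp: g_def)
  define r where "r = rec_nat b (\<lambda>_ c. c - f (g c))"
  have r0: "r 0 = b" and rS: "r (Suc n) = r n - f (g (r n))" for n by (simp_all add: r_def)
  have sub: "c - f a \<in> closure (range f)" if c: "c \<in> closure (range f)" for c a
    unfolding closure_approachable
  proof (intro allI impI)
    fix e :: real assume "e > 0"
    then obtain x where "dist (f x) c < e" using c by (auto simp: closure_approachable)
    thus "\<exists>y\<in>range f. dist y (c - f a) < e"
      by (intro bexI[OF _ rangeI[of f "x - a"]]) (simp add: f.diff dist_norm)
  qed
  have rc: "r n \<in> closure (range f)" for n
  proof (induction n)
    case 0 show ?case using b by (simp add: r0)
  next
    case (Suc n)
    thus ?case using sub by (simp add: rS)
  qed
  have nr: "norm (r n) \<le> q ^ n * norm b" for n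
  proof (induction n)
    case 0 show ?case by (simp add: r0)
  next
    case (Suc n)
    have "norm (r (Suc n)) \<le> q * norm (r n)" using g(2)[OF rc] by (simp add: rS)
    also have "\<dots> \<le> q * (q ^ n * norm b)" using Suc q by (intro mult_left_mono)
    finally show ?case by (simp add: mult.assoc)
  qed
  have ng: "norm (g (r n)) \<le> K * norm b * q ^ n" for n
  proof -
    have "norm (g (r n)) \<le> K * norm (r n)" by (rule g(1)[OF rc])
    also have "\<dots> \<le> K * (q ^ n * norm b)" by (intro mult_left_mono nr K)
    finally show ?thesis by (simp add: mult_ac)
  qed
  have geo: "(\<lambda>n. K * norm b * q ^ n) sums (K * norm b * (1 / (1 - q)))"
    using geometric_sums[of q] q by (intro sums_mult) simp
  have sumg: "summable (\<lambda>n. g (r n))"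
    by (rule summable_comparison_test'[OF sums_summable[OF geo], of 0]) (rule ng)
  let ?a = "\<Sum>n. g (r n)"
  have "norm ?a \<le> K * norm b * (1 / (1 - q))"
    using norm_suminf_le[OF ng sums_summable[OF geo]] sums_unique[OF geo] by simp
  moreover have "f ?a = b"
  proof -
    have part: "f (\<Sum>n<k. g (r n)) = b - r k" for k
      by (induction k) (simp_all add: r0 rS f.add f.zero)
    have "r \<longlonglongrightarrow> 0"
    proof (rule Lim_null_comparison)
      show "\<forall>\<^sub>F n in sequentially. norm (r n) \<le> q ^ n * norm b" using nr by simp
      show "(\<lambda>n. q ^ n * norm b) \<longlonglongrightarrow> 0"
        using q by (intro tendsto_mult_left_zero LIMSEQ_realpow_zero)
    qed
    hence "(\<lambda>k. f (\<Sum>n<k. g (r n))) \<longlonglongrightarrow> b - 0" unfolding part by (intro tendsto_intros)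
    moreover have "(\<lambda>k. f (\<Sum>n<k. g (r n))) \<longlonglongrightarrow> f ?a"
      by (intro f.tendsto summable_LIMSEQ sumg)
    ultimately show ?thesis using LIMSEQ_unique by fastforce
  qed
  ultimately show ?thesis by (intro exI[of _ ?a]) (simp add: mult_ac)
qed

locale unital_representation =
  fixes \<pi> :: "'a::cstar_algebra \<Rightarrow> 'h::{chilbert_space, perfect_space} bop"
  assumes rep: "star_representation \<pi>" and unit: "\<pi> 1 = 1"
begin

lemma rep_add: "\<pi> (a + b) = \<pi> a + \<pi> b" and rep_mult: "\<pi> (a * b) = \<pi> a * \<pi> b"
  and rep_scaleC: "\<pi> (c *\<^sub>C a) = c *\<^sub>C \<pi> a" and rep_star: "\<pi> (a\<^sup>\<star>) = (\<pi> a)\<^sup>\<star>"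
  using rep by (simp_all add: star_representation_def)

lemma rep_scaleR: "\<pi> (r *\<^sub>R a) = r *\<^sub>R \<pi> a"
  using rep_scaleC[of "complex_of_real r" a] by (simp add: scaleC_of_real)

lemma rep_zero [simp]: "\<pi> 0 = 0" using rep_scaleC[of 0 0] by simp

lemma rep_minus: "\<pi> (- a) = - \<pi> a" using rep_scaleR[of "-1" a] by simp

lemma rep_diff: "\<pi> (a - b) = \<pi> a - \<pi> b" using rep_add[of a "- b"] by (simp add: rep_minus)

lemma rep_hermitian_part: "\<pi> (hermitian_part a) = hermitian_part (\<pi> a)"
  by (simp add: hermitian_part_def rep_scaleR rep_add rep_star)

lemma rep_power: "\<pi> (a ^ n) = \<pi> a ^ n" by (induction n) (simp_all add: unit rep_mult)

text \<open>Let \<open>t = \<parallel>\<pi> a\<parallel>\<close>. The self-adjoint operator \<open>\<pi> a\<close> has unit vectors \<open>w\<close> with \<open>\<parallel>\<pi> a w\<parallel>\<close> close to \<open>t\<close>, and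
for these \<open>w - t\<^sup>-\<^sup>2 (\<pi> a)\<^sup>2 w\<close> is close to \<open>0\<close>. If \<open>\<parallel>a\<parallel> < t\<close>, then \<open>1 - t\<^sup>-\<^sup>2 a\<^sup>2\<close> is invertible by the
Neumann series, hence its image is bounded below, a contradiction.\<close>
lemma rep_norm_selfadjoint:
  assumes a: "a\<^sup>\<star> = a"
  shows "norm (\<pi> a) \<le> norm a"
proof (rule ccontr)
  define t where "t = norm (\<pi> a)"
  assume "\<not> norm (\<pi> a) \<le> norm a"
  hence at: "norm a < t" by (simp add: t_def)
  hence t: "t > 0" using norm_ge_zero[of a] by linarith
  have "norm (inverse (t\<^sup>2) *\<^sub>R (a * a)) \<le> inverse (t\<^sup>2) * (norm a)\<^sup>2"
    using norm_mult_ineq[of a a] by (simp add: power2_eq_square mult_left_mono)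
  also have "\<dots> < inverse (t\<^sup>2) * t\<^sup>2" using at t by (intro mult_strict_left_mono power_strict_mono) auto
  also have "\<dots> = 1" using t by simp
  finally obtain b where b: "b * (1 - inverse (t\<^sup>2) *\<^sub>R (a * a)) = 1" using neumann_inverse by blast
  define K where "K = norm (\<pi> b) + 1"
  have K: "K \<ge> 1" by (simp add: K_def)
  hence "1 \<le> K\<^sup>2" by (rule one_le_power)
  hence k: "1 / (2 * K\<^sup>2) \<le> 1" by (simp add: divide_le_eq)
  \<comment> \<open>being bounded below by \<open>1 / K\<close> improves the operator bound \<open>t\<close> by a fixed factor\<close>
  have "(norm (bop_apply (\<pi> a) w))\<^sup>2 \<le> t\<^sup>2 * (1 - 1 / (2 * K\<^sup>2)) * (norm w)\<^sup>2" for w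
  proof -
    define w1 where "w1 = bop_apply (\<pi> a) w"
    define w2 where "w2 = bop_apply (\<pi> a) w1"
    define v where "v = w - inverse (t\<^sup>2) *\<^sub>R w2"
    have "w = bop_apply (\<pi> (b * (1 - inverse (t\<^sup>2) *\<^sub>R (a * a)))) w"
      by (simp add: b unit bop_apply_one)
    also have "\<dots> = bop_apply (\<pi> b) v"
      by (simp add: rep_mult rep_diff rep_scaleR unit bop_apply_mult v_def w2_def w1_def
          bop_apply_scaleR bop_apply_one bop_apply_diff)
    finally have "norm w \<le> norm (\<pi> b) * norm v" using norm_bop_apply[of "\<pi> b" v] by simp
    also have "\<dots> \<le> K * norm v" by (simp add: K_def mult_right_mono)
    finally have 1: "(norm w)\<^sup>2 \<le> K\<^sup>2 * (norm v)\<^sup>2"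
      by (metis power_mono norm_ge_zero power_mult_distrib)
    have n1: "norm w1 \<le> t * norm w" and n2: "norm w2 \<le> t * norm w1"
      using norm_bop_apply by (simp_all add: w1_def w2_def t_def)
    have c: "cinner w w2 = complex_of_real ((norm w1)\<^sup>2)"
      using cinner_star[of "\<pi> a" w w1] rep_star[of a] by (simp add: a w1_def w2_def cinner_self)
    have "cinner w (inverse (t\<^sup>2) *\<^sub>R w2) = complex_of_real (inverse (t\<^sup>2) * (norm w1)\<^sup>2)"
      by (simp add: scaleC_of_real[symmetric] cinner_scaleC_right c)
    hence "(norm v)\<^sup>2 = (norm w)\<^sup>2 + (norm w2 / t\<^sup>2)\<^sup>2 - 2 * (norm w1)\<^sup>2 / t\<^sup>2"
      unfolding v_def norm_diff_sq by (simp add: divide_inverse mult_ac del: of_real_mult)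
    also have "norm w2 / t\<^sup>2 \<le> norm w"
    proof -
      have "norm w2 \<le> t * (t * norm w)" using n1 n2 t by (meson order_trans mult_left_mono less_imp_le)
      thus ?thesis using t by (simp add: divide_le_eq power2_eq_square mult_ac)
    qed
    hence "(norm w2 / t\<^sup>2)\<^sup>2 \<le> (norm w)\<^sup>2" by (intro power_mono) simp_all
    finally have 2: "(norm v)\<^sup>2 \<le> 2 * ((norm w)\<^sup>2 - (norm w1)\<^sup>2 / t\<^sup>2)" by simp
    have "(norm w)\<^sup>2 \<le> K\<^sup>2 * (2 * ((norm w)\<^sup>2 - (norm w1)\<^sup>2 / t\<^sup>2))"
      using 1 mult_left_mono[OF 2, of "K\<^sup>2"] by simp
    thus ?thesis using K t by (simp add: w1_def field_simps)
  qed
  hence "norm (bop_apply (\<pi> a) w) \<le> (t * sqrt (1 - 1 / (2 * K\<^sup>2))) * norm w" for w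
  proof -
    have "(norm (bop_apply (\<pi> a) w))\<^sup>2 \<le> ((t * sqrt (1 - 1 / (2 * K\<^sup>2))) * norm w)\<^sup>2"
      using \<open>\<And>w. (norm (bop_apply (\<pi> a) w))\<^sup>2 \<le> _\<close>[of w] k by (simp add: power_mult_distrib)
    thus ?thesis by (rule power2_le_imp_le) (use t k in simp)
  qed
  moreover have "0 \<le> t * sqrt (1 - 1 / (2 * K\<^sup>2))"
    using t k by simp
  ultimately have "t \<le> t * sqrt (1 - 1 / (2 * K\<^sup>2))" unfolding t_def[of] by (intro norm_bop_leI) auto
  hence "1 \<le> sqrt (1 - 1 / (2 * K\<^sup>2))" using t by simp
  hence "1 \<le> 1 - 1 / (2 * K\<^sup>2)" by simp
  moreover have "0 < 1 / (2 * K\<^sup>2)" using K by simp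
  ultimately show False by linarith
qed

lemma rep_norm: "norm (\<pi> a) \<le> norm a"
proof -
  have "(norm (\<pi> a))\<^sup>2 = norm (\<pi> (a\<^sup>\<star> * a))" by (simp add: rep_mult rep_star cstar_identity)
  also have "\<dots> \<le> norm (a\<^sup>\<star> * a)" by (rule rep_norm_selfadjoint) (simp add: star_mult star_star)
  finally have "(norm (\<pi> a))\<^sup>2 \<le> (norm a)\<^sup>2" by (simp add: cstar_identity)
  thus ?thesis by (rule power2_le_imp_le) simp
qed

lemma rep_bounded_linear: "bounded_linear \<pi>"
  by (rule bounded_linear_intro[where K = 1]) (simp_all add: rep_add rep_scaleR rep_norm)

text \<open>After scaling to \<open>\<parallel>\<pi> a\<parallel> = 1/2\<close>, the bounded transform \<open>b\<close> of \<open>a\<close> satisfies \<open>\<pi> a - \<pi> b = \<pi> b (\<pi> a)\<^sup>2\<close>, which has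
norm at most \<open>1/6\<close>, a third of \<open>\<parallel>\<pi> a\<parallel>\<close>. The bound on \<open>d\<close> involves only \<open>\<parallel>\<pi> a\<parallel>\<close> and not \<open>\<parallel>a\<parallel>\<close>.\<close>
lemma approximate_lift_selfadjoint:
  assumes a: "a\<^sup>\<star> = a"
  shows "\<exists>d. norm d \<le> 2 * norm (\<pi> a) \<and> norm (\<pi> a - \<pi> d) \<le> norm (\<pi> a) / 3"
proof (cases "\<pi> a = 0")
  case True thus ?thesis by (intro exI[of _ 0]) simp
next
  case False
  define s where "s = 2 * norm (\<pi> a)"
  have s: "s > 0" using False by (simp add: s_def)
  define a0 where "a0 = inverse s *\<^sub>R a"
  have "a0\<^sup>\<star> = a0" by (simp add: a0_def star_scaleR a)
  then obtain b where b: "norm b \<le> 1" "b * (1 + a0 * a0) = a0"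
    using selfadjoint_bounded_transform by blast
  have n0: "norm (\<pi> a0) = 1 / 2" using False by (simp add: a0_def rep_scaleR s_def)
  have "\<pi> b * (1 + \<pi> a0 * \<pi> a0) = \<pi> a0" using arg_cong[OF b(2), of \<pi>] by (simp add: rep_mult rep_add unit)
  hence eq: "\<pi> a0 - \<pi> b = \<pi> b * (\<pi> a0 * \<pi> a0)" by (simp add: algebra_simps)
  have "norm (\<pi> b * (\<pi> a0 * \<pi> a0)) \<le> norm (\<pi> b) * (norm (\<pi> a0) * norm (\<pi> a0))"
    by (meson mult_left_mono norm_ge_zero norm_mult_ineq order_trans)
  hence d: "norm (\<pi> a0 - \<pi> b) \<le> norm (\<pi> b) / 4" by (simp add: eq n0)
  have "norm (\<pi> b) \<le> norm (\<pi> a0) + norm (\<pi> a0 - \<pi> b)" by (metis norm_triangle_sub norm_minus_commute)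
  hence d': "norm (\<pi> a0 - \<pi> b) \<le> 1 / 6" using d n0 by simp
  have "\<pi> a - \<pi> (s *\<^sub>R b) = s *\<^sub>R (\<pi> a0 - \<pi> b)"
    using s by (simp add: a0_def rep_scaleR algebra_simps)
  hence "norm (\<pi> a - \<pi> (s *\<^sub>R b)) = s * norm (\<pi> a0 - \<pi> b)" using s by simp
  also have "\<dots> \<le> s * (1 / 6)" using d' s by (intro mult_left_mono) auto
  finally have "norm (\<pi> a - \<pi> (s *\<^sub>R b)) \<le> norm (\<pi> a) / 3" by (simp add: s_def)
  moreover have "norm (s *\<^sub>R b) \<le> 2 * norm (\<pi> a)"
    using b(1) s mult_left_mono[of "norm b" 1 s] by (simp add: s_def)
  ultimately show ?thesis by blast
qed

lemma approximate_lift: "\<exists>d. norm d \<le> 4 * norm (\<pi> a) \<and> norm (\<pi> a - \<pi> d) \<le> 2 / 3 * norm (\<pi> a)"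
proof -
  define h where "h = hermitian_part a"
  define k where "k = hermitian_part (- \<i> *\<^sub>C a)"
  have h: "h\<^sup>\<star> = h" and k: "k\<^sup>\<star> = k" by (simp_all add: h_def k_def hermitian_part_star)
  have a: "a = h + \<i> *\<^sub>C k" unfolding h_def k_def by (rule cartesian_decomposition)
  have nh: "norm (\<pi> h) \<le> norm (\<pi> a)"
    by (simp add: h_def rep_hermitian_part norm_hermitian_part)
  have nk: "norm (\<pi> k) \<le> norm (\<pi> a)"
    using norm_hermitian_part[of "\<pi> (- \<i> *\<^sub>C a)"]
    by (simp add: k_def rep_hermitian_part rep_scaleC norm_scaleC)
  obtain d1 where d1: "norm d1 \<le> 2 * norm (\<pi> h)" "norm (\<pi> h - \<pi> d1) \<le> norm (\<pi> h) / 3"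
    using approximate_lift_selfadjoint[OF h] by blast
  obtain d2 where d2: "norm d2 \<le> 2 * norm (\<pi> k)" "norm (\<pi> k - \<pi> d2) \<le> norm (\<pi> k) / 3"
    using approximate_lift_selfadjoint[OF k] by blast
  have "norm (d1 + \<i> *\<^sub>C d2) \<le> 4 * norm (\<pi> a)"
    using norm_triangle_ineq[of d1 "\<i> *\<^sub>C d2"] d1 d2 nh nk by (simp add: norm_scaleC)
  moreover have "\<pi> a - \<pi> (d1 + \<i> *\<^sub>C d2) = (\<pi> h - \<pi> d1) + \<i> *\<^sub>C (\<pi> k - \<pi> d2)"
    by (subst a) (simp add: rep_add rep_scaleC scaleC_diff_right)
  hence "norm (\<pi> a - \<pi> (d1 + \<i> *\<^sub>C d2)) \<le> 2 / 3 * norm (\<pi> a)"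
    using norm_triangle_ineq[of "\<pi> h - \<pi> d1" "\<i> *\<^sub>C (\<pi> k - \<pi> d2)"] d1 d2 nh nk by (simp add: norm_scaleC)
  ultimately show ?thesis by blast
qed

text \<open>The relative error \<open>2/3\<close> of \<open>approximate_lift\<close> leaves room to replace a point \<open>b\<close> of the closure by
a point of the range within \<open>\<parallel>b\<parallel> / 10\<close>: the constants become \<open>4.4 \<le> 5\<close> and \<open>5/6 \<le> 9/10\<close>, and
\<open>50 = 5 / (1 - 9/10)\<close>.\<close>
lemma bounded_lift:
  assumes "b \<in> closure (range \<pi>)"
  shows "\<exists>a. \<pi> a = b \<and> norm a \<le> 50 * norm b"
proof -
  have "\<exists>a. norm a \<le> 5 * norm b \<and> norm (b - \<pi> a) \<le> 9 / 10 * norm b"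
    if b: "b \<in> closure (range \<pi>)" for b
  proof (cases "b = 0")
    case True thus ?thesis by (intro exI[of _ 0]) simp
  next
    case False
    hence "norm b / 10 > 0" by simp
    then obtain c where c: "norm (\<pi> c - b) < norm b / 10"
      using b closure_approachable[of b "range \<pi>"] by (auto simp only: dist_norm)
    obtain d where d: "norm d \<le> 4 * norm (\<pi> c)" "norm (\<pi> c - \<pi> d) \<le> 2 / 3 * norm (\<pi> c)"
      using approximate_lift by blast
    have nc: "norm (\<pi> c) \<le> 11 / 10 * norm b" using c norm_triangle_sub[of "\<pi> c" b] by simp
    have "norm (b - \<pi> d) \<le> norm (\<pi> c - b) + norm (\<pi> c - \<pi> d)"
      by (metis norm_minus_commute norm_triangle_ineq diff_add_cancel add_diff_eq)
    hence "norm (b - \<pi> d) \<le> 9 / 10 * norm b" using c d nc norm_ge_zero[of b] by linarith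
    moreover have "norm d \<le> 5 * norm b" using d nc norm_ge_zero[of b] by linarith
    ultimately show ?thesis by blast
  qed
  thus ?thesis
    using closed_range_lifting[OF rep_bounded_linear, of 5 "9/10" b] assms by simp
qed

lemma closed_range: "closed (range \<pi>)"
  using bounded_lift closure_subset[of "range \<pi>"] by (metis closure_closed closure_eq rangeI subset_antisym subsetI)

lemma cstar_subalgebra_range: "cstar_subalgebra (range \<pi>)"
proof -
  have "0 \<in> range \<pi>" by (metis rep_zero rangeI)
  moreover have "\<pi> a + \<pi> b \<in> range \<pi>" "\<pi> a * \<pi> b \<in> range \<pi>" "c *\<^sub>C \<pi> a \<in> range \<pi>" "(\<pi> a)\<^sup>\<star> \<in> range \<pi>" for a b c
    by (metis rep_add rep_mult rep_scaleC rep_star rangeI)+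
  ultimately show ?thesis using closed_range unfolding cstar_subalgebra_def by blast
qed

end

section \<open>Normalizers and the conditional expectation\<close>

lemma cstar_subalgebra_Int: "cstar_subalgebra A \<Longrightarrow> cstar_subalgebra B \<Longrightarrow> cstar_subalgebra (A \<inter> B)"
  unfolding cstar_subalgebra_def by (simp add: closed_Int)

definition commutant :: "'a::cstar_algebra set \<Rightarrow> 'a set" where
  "commutant S = {b. \<forall>s\<in>S. b * s = s * b}"

lemma cstar_subalgebra_commutant:
  assumes "\<And>s. s \<in> S \<Longrightarrow> s\<^sup>\<star> \<in> S"
  shows "cstar_subalgebra (commutant S)"
  unfolding cstar_subalgebra_def
proof (intro conjI ballI allI)
  have "commutant S = (\<Inter>s\<in>S. {b. b * s = s * b})" by (auto simp: commutant_def)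
  thus "closed (commutant S)"
    by (simp add: closed_INT closed_Collect_eq continuous_intros)
  show "0 \<in> commutant S" by (simp add: commutant_def)
  fix x y assume x: "x \<in> commutant S" and y: "y \<in> commutant S"
  show "x + y \<in> commutant S" using x y by (simp add: commutant_def distrib_left distrib_right)
  show "x * y \<in> commutant S" using x y by (simp add: commutant_def) (metis mult.assoc)
next
  fix c x assume x: "x \<in> commutant S"
  thus "c *\<^sub>C x \<in> commutant S" by (simp add: commutant_def mult_scaleC_left mult_scaleC_right)
next
  fix x assume x: "x \<in> commutant S"
  have "x\<^sup>\<star> * s = s * x\<^sup>\<star>" if "s \<in> S" for s
  proof -
    have "x * s\<^sup>\<star> = s\<^sup>\<star> * x" using x assms[OF that] by (simp add: commutant_def)
    from arg_cong[OF this, of star] show ?thesis by (simp add: star_mult star_star)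
  qed
  thus "x\<^sup>\<star> \<in> commutant S" by (simp add: commutant_def)
qed

text \<open>A self-adjoint element that commutes with \<open>M\<close> lies, together with \<open>M\<close>, in an abelian C*-subalgebra,
namely in the double commutant of \<open>M \<union> {a}\<close>. In general this is applied to the real and
imaginary parts of \<open>x\<close>.\<close>
lemma maximal_abelian_commutant:
  assumes M: "maximal_abelian UNIV M" and x: "\<And>h. h \<in> M \<Longrightarrow> x * h = h * x"
  shows "x \<in> M"
proof -
  have Msub: "cstar_subalgebra M" and Mab: "abelian M"
    and Mmax: "\<And>B. cstar_subalgebra B \<Longrightarrow> abelian B \<Longrightarrow> M \<subseteq> B \<Longrightarrow> B = M"
    using M by (auto simp: maximal_abelian_def)
  have Mstar: "h\<^sup>\<star> \<in> M" if "h \<in> M" for h using Msub that by (simp add: cstar_subalgebra_def)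
  have sa: "a \<in> M" if a: "a\<^sup>\<star> = a" and comm: "\<And>h. h \<in> M \<Longrightarrow> a * h = h * a" for a
  proof -
    define C where "C = commutant (insert a M)"
    define B where "B = commutant C"
    have subC: "cstar_subalgebra C"
      unfolding C_def by (rule cstar_subalgebra_commutant) (use a Mstar in auto)
    hence "cstar_subalgebra B"
      unfolding B_def by (intro cstar_subalgebra_commutant) (simp add: cstar_subalgebra_def)
    moreover have SC: "insert a M \<subseteq> C"
      using Mab comm by (auto simp: C_def commutant_def abelian_def)
    have SB: "insert a M \<subseteq> B" by (auto simp: B_def C_def commutant_def)
    have "B \<subseteq> C" using SC by (auto simp: B_def C_def commutant_def)
    hence "abelian B" by (auto simp: abelian_def B_def commutant_def)
    ultimately have "B = M" using SB by (intro Mmax) auto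
    thus ?thesis using SB by blast
  qed
  have xs: "x\<^sup>\<star> * h = h * x\<^sup>\<star>" if "h \<in> M" for h
    using arg_cong[OF x[OF Mstar[OF that]], of star] by (simp add: star_mult star_star)
  have hp: "hermitian_part (c *\<^sub>C x) \<in> M" for c
    by (rule sa[OF hermitian_part_star])
       (simp add: hermitian_part_def star_scaleC distrib_left distrib_right x xs
         mult_scaleC_left mult_scaleC_right)
  have "hermitian_part x + \<i> *\<^sub>C hermitian_part (- \<i> *\<^sub>C x) \<in> M"
    using hp[of 1] hp[of "- \<i>"] Msub by (simp add: cstar_subalgebra_def)
  thus ?thesis using cartesian_decomposition[of x] by simp
qed

locale cartan_expectation =
  fixes M :: "'a::cstar_algebra set" and E :: "'a \<Rightarrow> 'a"
  assumes cartan: "cartan_pair UNIV M" and expectation: "conditional_expectation UNIV M E"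
begin

lemma M_masa: "maximal_abelian UNIV M" and M_one: "1 \<in> M"
  and normalizers_generate: "cstar_generated (normalizers UNIV M) = UNIV"
  using cartan by (simp_all add: cartan_pair_def)

lemma M_subalgebra: "cstar_subalgebra M" and M_abelian: "abelian M"
  using M_masa by (simp_all add: maximal_abelian_def)

lemma M_zero: "0 \<in> M"
  and M_add: "h \<in> M \<Longrightarrow> k \<in> M \<Longrightarrow> h + k \<in> M"
  and M_mult: "h \<in> M \<Longrightarrow> k \<in> M \<Longrightarrow> h * k \<in> M"
  and M_scaleC: "h \<in> M \<Longrightarrow> c *\<^sub>C h \<in> M"
  and M_star: "h \<in> M \<Longrightarrow> h\<^sup>\<star> \<in> M"
  using M_subalgebra by (auto simp: cstar_subalgebra_def)

lemma M_diff: "h \<in> M \<Longrightarrow> k \<in> M \<Longrightarrow> h - k \<in> M"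
  using M_add[of h "(-1) *\<^sub>C k"] M_scaleC[of k "-1"] by simp

lemma M_commute: "h \<in> M \<Longrightarrow> k \<in> M \<Longrightarrow> h * k = k * h"
  using M_abelian by (simp add: abelian_def)

lemma M_left_commute: "h \<in> M \<Longrightarrow> k \<in> M \<Longrightarrow> h * (k * a) = k * (h * a)"
  using M_commute[of h k] by (metis mult.assoc)

lemmas M_closed = M_zero M_one M_add M_mult M_scaleC M_star M_diff

lemma E_in [simp]: "E a \<in> M" and E_add: "E (a + b) = E a + E b"
  and E_scaleC: "E (c *\<^sub>C a) = c *\<^sub>C E a" and E_norm: "norm (E a) \<le> norm a"
  and E_positive: "\<exists>b. E (a\<^sup>\<star> * a) = b\<^sup>\<star> * b"
  and E_fix: "h \<in> M \<Longrightarrow> E h = h"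
  and E_mult_left: "h \<in> M \<Longrightarrow> E (h * a) = h * E a"
  and E_mult_right: "h \<in> M \<Longrightarrow> E (a * h) = E a * h"
  using expectation by (auto simp: conditional_expectation_def)

lemma E_scaleR: "E (r *\<^sub>R a) = r *\<^sub>R E a"
  using E_scaleC[of "complex_of_real r" a] by (simp add: scaleC_of_real)

lemma E_zero [simp]: "E 0 = 0" by (simp add: E_fix M_zero)

lemma E_diff: "E (a - b) = E a - E b"
  using E_add[of "a - b" b] by simp

lemma E_bounded_linear: "bounded_linear E"
  by (rule bounded_linear_intro[where K = 1]) (simp_all add: E_add E_scaleR E_norm)

lemma E_star: "E (a\<^sup>\<star>) = (E a)\<^sup>\<star>"
proof -
  have sa: "(E h)\<^sup>\<star> = E h" if h: "h\<^sup>\<star> = h" for h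
  proof -
    obtain b where b: "E ((1 + h)\<^sup>\<star> * (1 + h)) = b\<^sup>\<star> * b" using E_positive by blast
    obtain c where c: "E ((1 - h)\<^sup>\<star> * (1 - h)) = c\<^sup>\<star> * c" using E_positive by blast
    \<comment> \<open>polarization writes \<open>h\<close> as a difference of positive elements\<close>
    have "4 *\<^sub>R h = 2 *\<^sub>R h + 2 *\<^sub>R h" by (simp flip: scaleR_add_left)
    also have "\<dots> = (1 + h)\<^sup>\<star> * (1 + h) - (1 - h)\<^sup>\<star> * (1 - h)"
      by (simp add: star_add star_diff h algebra_simps scaleR_2)
    finally have "4 *\<^sub>R h = (1 + h)\<^sup>\<star> * (1 + h) - (1 - h)\<^sup>\<star> * (1 - h)" .
    hence "E (4 *\<^sub>R h) = b\<^sup>\<star> * b - c\<^sup>\<star> * c" by (simp only: E_diff b c)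
    hence "4 *\<^sub>R E h = b\<^sup>\<star> * b - c\<^sup>\<star> * c" by (simp only: E_scaleR)
    moreover from arg_cong[OF this, of star] have "4 *\<^sub>R (E h)\<^sup>\<star> = b\<^sup>\<star> * b - c\<^sup>\<star> * c"
      by (simp add: star_scaleR star_diff star_mult star_star)
    ultimately have "4 *\<^sub>R (E h)\<^sup>\<star> = 4 *\<^sub>R E h" by simp
    thus ?thesis by simp
  qed
  define h k where "h = hermitian_part a" and "k = hermitian_part (- \<i> *\<^sub>C a)"
  have hk: "h\<^sup>\<star> = h" "k\<^sup>\<star> = k" by (simp_all add: h_def k_def hermitian_part_star)
  have a: "a = h + \<i> *\<^sub>C k" unfolding h_def k_def by (rule cartesian_decomposition)
  show ?thesis by (simp add: a star_add star_scaleC E_add E_scaleC hk sa)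
qed

text \<open>The normalizers together with \<open>0\<close>, which makes the set closed under products.\<close>
definition N :: "'a set" where
  "N = {n. \<forall>h\<in>M. n\<^sup>\<star> * h * n \<in> M \<and> n * h * n\<^sup>\<star> \<in> M}"

lemma N_eq: "N = insert 0 (normalizers UNIV M)"
  using M_zero by (auto simp: N_def normalizers_def)

lemma N_conj: "n \<in> N \<Longrightarrow> h \<in> M \<Longrightarrow> n\<^sup>\<star> * h * n \<in> M" "n \<in> N \<Longrightarrow> h \<in> M \<Longrightarrow> n * h * n\<^sup>\<star> \<in> M"
  by (simp_all add: N_def)

lemma N_square: "n \<in> N \<Longrightarrow> n\<^sup>\<star> * n \<in> M" "n \<in> N \<Longrightarrow> n * n\<^sup>\<star> \<in> M"
  using N_conj[of n 1] M_one by simp_all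

lemma N_one: "1 \<in> N" by (simp add: N_def)

lemma N_star: "n \<in> N \<Longrightarrow> n\<^sup>\<star> \<in> N" by (simp add: N_def star_star)

lemma N_scaleC: "n \<in> N \<Longrightarrow> c *\<^sub>C n \<in> N"
  by (simp add: N_def star_scaleC mult_scaleC_left mult_scaleC_right M_scaleC)

lemma N_mult:
  assumes n: "n \<in> N" and m: "m \<in> N" shows "n * m \<in> N"
  unfolding N_def
proof (intro CollectI ballI conjI)
  fix h assume h: "h \<in> M"
  have "m\<^sup>\<star> * (n\<^sup>\<star> * h * n) * m \<in> M" "n * (m * h * m\<^sup>\<star>) * n\<^sup>\<star> \<in> M"
    by (rule N_conj[OF m N_conj(1)[OF n h]] N_conj[OF n N_conj(2)[OF m h]])+
  thus "(n * m)\<^sup>\<star> * h * (n * m) \<in> M" "(n * m) * h * (n * m)\<^sup>\<star> \<in> M"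
    by (simp_all add: star_mult mult.assoc)
qed

lemma span_N_scaleC: "x \<in> span N \<Longrightarrow> c *\<^sub>C x \<in> span N"
  by (induction rule: span_induct_alt)
     (simp_all add: span_zero scaleC_add_right scaleC_scaleR span_add span_scale span_base N_scaleC)

lemma span_N_star: "x \<in> span N \<Longrightarrow> x\<^sup>\<star> \<in> span N"
  by (induction rule: span_induct_alt)
     (simp_all add: span_zero star_add star_scaleR span_add span_scale span_base N_star)

lemma span_N_mult:
  assumes x: "x \<in> span N" and y: "y \<in> span N" shows "x * y \<in> span N"
proof -
  have n: "n * y \<in> span N" if "n \<in> N" for n
    using y by (induction rule: span_induct_alt)
      (simp_all add: span_zero distrib_left span_add span_scale span_base N_mult that)
  show ?thesis
    using x by (induction rule: span_induct_alt) (simp_all add: span_zero distrib_right span_add span_scale n)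
qed

lemma cstar_subalgebra_closure_span_N: "cstar_subalgebra (closure (span N))"
  unfolding cstar_subalgebra_def
proof (intro conjI ballI allI)
  show "0 \<in> closure (span N)" using closure_subset[of "span N"] span_zero[of N] by blast
  fix x y assume x: "x \<in> closure (span N)" and y: "y \<in> closure (span N)"
  obtain u where u: "\<And>k. u k \<in> span N" "u \<longlonglongrightarrow> x"
    using x unfolding closure_sequential by blast
  obtain w where w: "\<And>k. w k \<in> span N" "w \<longlonglongrightarrow> y"
    using y unfolding closure_sequential by blast
  show "x + y \<in> closure (span N)" unfolding closure_sequential
    by (intro exI[of _ "\<lambda>k. u k + w k"] conjI allI tendsto_add[OF u(2) w(2)] span_add[OF u(1) w(1)])
  show "x * y \<in> closure (span N)" unfolding closure_sequential
    by (intro exI[of _ "\<lambda>k. u k * w k"] conjI allI tendsto_mult[OF u(2) w(2)]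
        span_N_mult[OF u(1) w(1)])
next
  fix c x assume "x \<in> closure (span N)"
  then obtain u where u: "\<And>k. u k \<in> span N" "u \<longlonglongrightarrow> x"
    unfolding closure_sequential by blast
  show "c *\<^sub>C x \<in> closure (span N)" unfolding closure_sequential
    by (intro exI[of _ "\<lambda>k. c *\<^sub>C u k"] conjI allI span_N_scaleC[OF u(1)]
        bounded_linear.tendsto[OF bounded_linear_scaleC u(2)])
next
  fix x assume "x \<in> closure (span N)"
  then obtain u where u: "\<And>k. u k \<in> span N" "u \<longlonglongrightarrow> x"
    unfolding closure_sequential by blast
  show "x\<^sup>\<star> \<in> closure (span N)" unfolding closure_sequential
    by (intro exI[of _ "\<lambda>k. (u k)\<^sup>\<star>"] conjI allI span_N_star[OF u(1)]
        bounded_linear.tendsto[OF bounded_linear_star u(2)])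
qed simp

text \<open>Regularity in usable form: as the normalizers are closed under products, adjoints and scalars, their
closed linear span is already the C*-algebra that they generate.\<close>
lemma normalizer_induct:
  assumes cl: "closed {a. P a}" and add: "\<And>a b. P a \<Longrightarrow> P b \<Longrightarrow> P (a + b)"
    and n: "\<And>n. n \<in> N \<Longrightarrow> P n"
  shows "P a"
proof -
  have "normalizers UNIV M \<subseteq> closure (span N)"
    using N_eq span_superset closure_subset by blast
  hence "cstar_generated (normalizers UNIV M) \<subseteq> closure (span N)"
    using cstar_subalgebra_closure_span_N by (auto simp: cstar_generated_def)
  hence "a \<in> closure (span N)" using normalizers_generate by blast
  moreover have "P x" if "x \<in> span N" for x
    using that
  proof (rule span_induct_alt)
    show "P 0" by (rule n) (simp add: N_eq)
    fix c x y assume "x \<in> N" "P y"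
    thus "P (c *\<^sub>R x + y)"
      using add n N_scaleC[of x "complex_of_real c"] by (simp add: scaleC_of_real)
  qed
  ultimately show ?thesis using closure_minimal[OF _ cl, of "span N"] by blast
qed

text \<open>Put \<open>e = E m\<close>. From \<open>(m h m\<^sup>\<star>) m = m (h m\<^sup>\<star> m)\<close> and the module property, \<open>(m h m\<^sup>\<star>) e = e h m\<^sup>\<star> m\<close> for
\<open>h \<in> M\<close>; pointwise this says that \<open>\<alpha>\<^sub>m\<close> fixes every point where \<open>e\<close> does not vanish. It implies that
\<open>d = e\<^sup>\<star> (m k - k m)\<close> satisfies \<open>d d\<^sup>\<star> = 0\<close> for \<open>k \<in> M\<close>. So \<open>e\<^sup>\<star> m\<close> commutes with \<open>M\<close>, hence belongs to
\<open>M\<close>, and is therefore equal to its own expectation \<open>e\<^sup>\<star> e\<close>.\<close>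
lemma E_normalizer_absorb:
  assumes m: "m \<in> N"
  shows "(E m)\<^sup>\<star> * m = (E m)\<^sup>\<star> * E m"
proof -
  define e where "e = E m"
  define c where "c = m\<^sup>\<star> * m"
  have c: "c \<in> M" using N_square m by (simp add: c_def)
  have e: "e \<in> M" by (simp add: e_def)
  have move: "(m * h * m\<^sup>\<star>) * e = e * (h * c)" if h: "h \<in> M" for h
  proof -
    have "(m * h * m\<^sup>\<star>) * e = E ((m * h * m\<^sup>\<star>) * m)"
      using E_mult_left[OF N_conj(2)[OF m h]] by (simp add: e_def)
    also have "(m * h * m\<^sup>\<star>) * m = m * (h * c)" by (simp add: c_def mult.assoc)
    also have "E \<dots> = e * (h * c)"
      using E_mult_right[OF M_mult[OF h c]] by (simp add: e_def)
    finally show ?thesis .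
  qed
  have "(e\<^sup>\<star> * m) * k = k * (e\<^sup>\<star> * m)" if k: "k \<in> M" for k
  proof -
    define d where "d = e\<^sup>\<star> * (m * k - k * m)"
    have k': "k\<^sup>\<star> \<in> M" using k by (rule M_star)
    have ek: "k\<^sup>\<star> * e = e * k\<^sup>\<star>" using M_commute[OF k' e] .
    have "d * d\<^sup>\<star> = e\<^sup>\<star> * ((m * (k * k\<^sup>\<star>) * m\<^sup>\<star>) * e - (m * k * m\<^sup>\<star>) * (k\<^sup>\<star> * e)
        - k * ((m * k\<^sup>\<star> * m\<^sup>\<star>) * e) + k * ((m * 1 * m\<^sup>\<star>) * (k\<^sup>\<star> * e)))"
      by (simp add: d_def star_mult star_diff star_star algebra_simps)
    also have "\<dots> = e\<^sup>\<star> * ((m * (k * k\<^sup>\<star>) * m\<^sup>\<star>) * e - (m * k * m\<^sup>\<star>) * e * k\<^sup>\<star>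
        - k * ((m * k\<^sup>\<star> * m\<^sup>\<star>) * e) + k * ((m * 1 * m\<^sup>\<star>) * e * k\<^sup>\<star>))"
      by (simp only: ek mult.assoc)
    also have "\<dots> = e\<^sup>\<star> * (e * ((k * k\<^sup>\<star>) * c) - e * (k * c) * k\<^sup>\<star>
        - k * (e * (k\<^sup>\<star> * c)) + k * (e * (1 * c) * k\<^sup>\<star>))"
      using k k' M_one by (simp only: move M_mult)
    also have "\<dots> = 0"
      using k k' e c by (simp add: mult.assoc M_commute M_left_commute M_mult)
    finally have "d = 0" by simp
    hence "e\<^sup>\<star> * m * k = e\<^sup>\<star> * k * m" by (simp add: d_def algebra_simps)
    also have "\<dots> = k * (e\<^sup>\<star> * m)" using M_commute[OF M_star[OF e] k] by (simp add: mult.assoc[symmetric])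
    finally show ?thesis .
  qed
  hence "e\<^sup>\<star> * m \<in> M" by (rule maximal_abelian_commutant[OF M_masa])
  hence "e\<^sup>\<star> * m = E (e\<^sup>\<star> * m)" by (simp add: E_fix)
  also have "\<dots> = e\<^sup>\<star> * e" by (simp add: E_mult_left M_star e_def)
  finally show ?thesis by (simp add: e_def)
qed

text \<open>By density it suffices to treat a normalizer \<open>a = m\<close>. Then \<open>r = n\<^sup>\<star> m n\<close> is a normalizer too, and
\<open>E_normalizer_absorb\<close> for \<open>m\<close> and for \<open>r\<close> shows that \<open>g = n\<^sup>\<star> E(m) n\<close> and \<open>e' = E r\<close> agree both where \<open>g\<close>
does not vanish and, after multiplication by powers of \<open>c = n\<^sup>\<star> n\<close>, where \<open>e'\<close> does not vanish.
Hence \<open>c (g - e') = 0\<close>. Since \<open>g\<close> and \<open>r\<close> both begin with the factor \<open>n\<^sup>\<star>\<close>, the factor \<open>c\<close> can be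
cancelled.\<close>
lemma E_covariant:
  assumes n: "n \<in> N"
  shows "E (n\<^sup>\<star> * a * n) = n\<^sup>\<star> * E a * n"
proof (induction a rule: normalizer_induct)
  case 1
  interpret E: bounded_linear E by (rule E_bounded_linear)
  show ?case
    by (intro closed_Collect_eq continuous_intros E.continuous_on)
next
  case (2 a b)
  thus ?case by (simp add: distrib_left distrib_right E_add)
next
  case (3 m)
  define e where "e = E m"
  define r where "r = n\<^sup>\<star> * m * n"
  define e' where "e' = E r"
  define g where "g = n\<^sup>\<star> * e * n"
  define c where "c = n\<^sup>\<star> * n"
  define z where "z = g - e'"
  have e: "e \<in> M" and e': "e' \<in> M" by (simp_all add: e_def e'_def)
  have g: "g \<in> M" using N_conj n e by (simp add: g_def)
  have z: "z \<in> M" using g e' by (simp add: z_def M_diff)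
  have c: "c \<in> M" using N_square n by (simp add: c_def)
  have r: "r \<in> N" unfolding r_def using n 3 by (intro N_mult N_star)
  have absorb: "e\<^sup>\<star> * m = e\<^sup>\<star> * e" "e'\<^sup>\<star> * r = e'\<^sup>\<star> * e'"
    using E_normalizer_absorb 3 r by (simp_all add: e_def e'_def)
  have gs: "g\<^sup>\<star> = n\<^sup>\<star> * e\<^sup>\<star> * n" by (simp add: g_def star_mult star_star mult.assoc)
  have gx: "g\<^sup>\<star> * (n\<^sup>\<star> * x * n) = n\<^sup>\<star> * (n * n\<^sup>\<star>) * (e\<^sup>\<star> * x) * n" for x
  proof -
    have "g\<^sup>\<star> * (n\<^sup>\<star> * x * n) = n\<^sup>\<star> * (e\<^sup>\<star> * (n * n\<^sup>\<star>)) * x * n" by (simp add: gs mult.assoc)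
    also have "e\<^sup>\<star> * (n * n\<^sup>\<star>) = (n * n\<^sup>\<star>) * e\<^sup>\<star>" using M_commute[OF M_star[OF e] N_square(2)[OF n]] .
    finally show ?thesis by (simp add: mult.assoc)
  qed
  have "g\<^sup>\<star> * r = g\<^sup>\<star> * g" unfolding r_def using gx[of m] gx[of e] absorb by (simp add: g_def)
  hence "E (g\<^sup>\<star> * r) = E (g\<^sup>\<star> * g)" by simp
  hence gz: "g\<^sup>\<star> * z = 0"
    using g by (simp add: E_mult_left E_fix M_star M_mult z_def right_diff_distrib e'_def[symmetric])
  \<comment> \<open>the identity for \<open>r\<close>, conjugated by \<open>n\<close> so that \<open>E\<close> can be applied to \<open>m\<close> itself\<close>
  have "E ((n * e'\<^sup>\<star> * n\<^sup>\<star>) * m * (n * n\<^sup>\<star>)) = E (n * (e'\<^sup>\<star> * e') * n\<^sup>\<star>)"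
    unfolding absorb(2)[symmetric] r_def by (simp add: mult.assoc)
  hence "(n * e'\<^sup>\<star> * n\<^sup>\<star>) * e * (n * n\<^sup>\<star>) = n * (e'\<^sup>\<star> * e') * n\<^sup>\<star>"
    using n e' N_conj(2)[OF n, of "e'\<^sup>\<star>"] N_conj(2)[OF n, of "e'\<^sup>\<star> * e'"] N_square(2)[OF n]
    by (simp add: E_mult_left E_mult_right E_fix M_star M_mult e_def[symmetric])
  hence "n\<^sup>\<star> * ((n * e'\<^sup>\<star> * n\<^sup>\<star>) * e * (n * n\<^sup>\<star>)) * n = n\<^sup>\<star> * (n * (e'\<^sup>\<star> * e') * n\<^sup>\<star>) * n" by simp
  hence "c * e'\<^sup>\<star> * g * c = c * e'\<^sup>\<star> * e' * c" by (simp add: c_def g_def mult.assoc)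
  hence e'z: "c * e'\<^sup>\<star> * z * c = 0" by (simp add: z_def left_diff_distrib right_diff_distrib)
  have cs: "c\<^sup>\<star> = c" by (simp add: c_def star_mult star_star)
  have "(z * c)\<^sup>\<star> * (z * c) = c * (g\<^sup>\<star> * z) * c - c * e'\<^sup>\<star> * z * c"
    by (simp add: star_mult cs z_def star_diff algebra_simps)
  hence "z * c = 0" using gz e'z by simp
  hence cz: "c * z = 0" using M_commute[OF z c] by simp
  \<comment> \<open>cancellation of \<open>c\<close>: \<open>z\<^sup>\<star>\<close> annihilates \<open>n\<^sup>\<star>\<close> and with it \<open>g\<close>, \<open>r\<close> and \<open>E r\<close>\<close>
  have "(n * z)\<^sup>\<star> * (n * z) = z\<^sup>\<star> * (c * z)" by (simp add: star_mult c_def mult.assoc)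
  hence "n * z = 0" using cz by simp
  hence zn: "z\<^sup>\<star> * n\<^sup>\<star> = 0" by (metis star_mult star_zero)
  have "z\<^sup>\<star> * g = 0" using zn by (simp add: g_def mult.assoc[symmetric])
  moreover have "z\<^sup>\<star> * r = 0" using zn by (simp add: r_def mult.assoc[symmetric])
  hence "z\<^sup>\<star> * e' = 0" using E_mult_left[OF M_star[OF z], of r] by (simp add: e'_def)
  ultimately have "z\<^sup>\<star> * z = 0" by (subst (2) z_def) (simp add: right_diff_distrib)
  hence "z = 0" by simp
  thus ?case by (simp add: z_def g_def e'_def r_def e_def)
qed

end

section \<open>The representation at a point with trivial isotropy\<close>

lemma bounded_linear_cinner_right: "bounded_linear (\<lambda>y. cinner (x::'h::complex_inner) y)"
  by (rule bounded_linear_intro[where K = "norm x"])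
     (simp_all add: cinner_add_right scaleC_of_real[symmetric] cinner_scaleC_right
       scaleR_conv_of_real cinner_cauchy_schwarz mult.commute[of _ "norm x"])

locale gns_cartan =
  cartan_expectation M E + unital_representation \<pi>
  for M :: "'a::cstar_algebra set" and E and \<pi> :: "'a \<Rightarrow> 'h::{chilbert_space, perfect_space} bop" +
  fixes x0 :: "'a \<Rightarrow> complex" and \<xi> :: 'h
  assumes x0: "x0 \<in> gelfand_space M"
    and isotropy: "\<not> nontrivial_isotropy UNIV M E x0"
    and cyclic: "closure (range (\<lambda>a. bop_apply (\<pi> a) \<xi>)) = UNIV"
    and state: "cinner (bop_apply (\<pi> a) \<xi>) \<xi> = x0 (E a)"
begin

lemma x0_mult: "h \<in> M \<Longrightarrow> k \<in> M \<Longrightarrow> x0 (h * k) = x0 h * x0 k"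
  using x0 by (simp add: gelfand_space_def)

lemma x0_one: "x0 1 = 1"
proof -
  obtain h where "h \<in> M" "x0 h \<noteq> 0" using x0 by (auto simp: gelfand_space_def)
  thus ?thesis using x0_mult[OF M_one, of h] by simp
qed

definition gns_vector :: "'a \<Rightarrow> 'h" where "gns_vector a = bop_apply (\<pi> a) \<xi>"

lemma gns_vector_mult: "gns_vector (a * b) = bop_apply (\<pi> a) (gns_vector b)"
  by (simp add: gns_vector_def rep_mult bop_apply_mult)

lemma gns_vector_add: "gns_vector (a + b) = gns_vector a + gns_vector b"
  by (simp add: gns_vector_def rep_add bop_apply_add)

lemma gns_vector_diff: "gns_vector (a - b) = gns_vector a - gns_vector b"
  by (simp add: gns_vector_def rep_diff bop_apply_diff)

lemma gns_vector_scaleC: "gns_vector (c *\<^sub>C a) = c *\<^sub>C gns_vector a"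
  by (simp add: gns_vector_def rep_scaleC bop_apply_scaleC_left)

lemma gns_vector_zero: "gns_vector 0 = 0" using gns_vector_diff[of 0 0] by simp

lemma bounded_linear_gns_vector: "bounded_linear gns_vector"
proof (rule bounded_linear_intro[where K = "norm \<xi>"])
  fix a
  have "norm (gns_vector a) \<le> norm (\<pi> a) * norm \<xi>" by (simp add: gns_vector_def norm_bop_apply)
  also have "\<dots> \<le> norm a * norm \<xi>" by (intro mult_right_mono rep_norm) simp
  finally show "norm (gns_vector a) \<le> norm a * norm \<xi>" .
next
  fix r a show "gns_vector (r *\<^sub>R a) = r *\<^sub>R gns_vector a"
    using gns_vector_scaleC[of "complex_of_real r" a] by (simp add: scaleC_of_real)
qed (rule gns_vector_add)

lemma cinner_gns_vector: "cinner (bop_apply (\<pi> a) (gns_vector b)) (gns_vector c) = x0 (E (c\<^sup>\<star> * a * b))"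
proof -
  have "cinner (gns_vector (a * b)) (bop_apply (\<pi> c) \<xi>) = cinner (bop_apply ((\<pi> c)\<^sup>\<star>) (gns_vector (a * b))) \<xi>"
    by (simp add: cinner_star_left)
  also have "\<dots> = cinner (gns_vector (c\<^sup>\<star> * (a * b))) \<xi>" by (simp add: rep_star gns_vector_mult)
  also have "\<dots> = x0 (E (c\<^sup>\<star> * (a * b)))" by (simp only: gns_vector_def state)
  finally show ?thesis by (simp only: gns_vector_mult gns_vector_def[symmetric] mult.assoc)
qed

lemma norm_gns_vector: "complex_of_real ((norm (gns_vector a))\<^sup>2) = x0 (E (a\<^sup>\<star> * a))"
  using cinner_gns_vector[of 1 a a] by (simp add: unit bop_apply_one cinner_self)

text \<open>The vectors \<open>\<pi> n \<xi>\<close> of the normalizers \<open>n\<close> are total, because the normalizers span a dense subspace of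
the algebra and \<open>\<xi>\<close> is cyclic.\<close>
lemma eq_0_if_eq_0_on_normalizer_vectors:
  fixes f :: "'h \<Rightarrow> 'b::real_normed_vector"
  assumes cont: "continuous_on UNIV f"
    and add: "\<And>x y. f (x + y) = f x + f y"
    and n: "\<And>n. n \<in> N \<Longrightarrow> f (gns_vector n) = 0"
  shows "f x = 0"
proof -
  have v: "f (gns_vector a) = 0" for a
  proof (induction a rule: normalizer_induct)
    case 1
    have "continuous_on UNIV (\<lambda>a. f (gns_vector a))"
      by (rule continuous_on_compose2[OF cont])
        (simp_all add: linear_continuous_on bounded_linear_gns_vector)
    thus ?case by (intro closed_Collect_eq continuous_intros)
  qed (simp_all add: gns_vector_add add n)
  have "closed {x. f x = 0}" using cont by (intro closed_Collect_eq continuous_intros)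
  hence "closure (range gns_vector) \<subseteq> {x. f x = 0}" using v by (intro closure_minimal) auto
  thus ?thesis using cyclic by (auto simp: gns_vector_def[abs_def])
qed

lemma operator_zero:
  assumes "\<And>n. n \<in> N \<Longrightarrow> bop_apply T (gns_vector n) = 0"
  shows "T = 0"
proof (rule bop_eqI)
  interpret T: bounded_linear "bop_apply T" by (rule bounded_linear_bop_apply)
  fix x
  have "bop_apply T x = 0"
    by (rule eq_0_if_eq_0_on_normalizer_vectors) (simp_all add: T.add assms T.continuous_on)
  thus "bop_apply T x = bop_apply 0 x" by (simp add: bop_apply_zero)
qed

text \<open>The point \<open>\<alpha>\<^sub>n(x\<^sub>0)\<close>. It is meaningful when \<open>x\<^sub>0\<close> is in the domain of \<open>\<alpha>\<^sub>n\<close>, that is, when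
\<open>\<pi> n \<xi> \<noteq> 0\<close>.\<close>
definition orbit_point :: "'a \<Rightarrow> 'a \<Rightarrow> complex" where "orbit_point n = alpha M n x0"

lemma gns_vector_nonzero:
  assumes n: "n \<in> N" and v: "gns_vector n \<noteq> 0"
  shows "n \<in> normalizers UNIV M" "x0 \<in> alpha_dom M n" "x0 (n\<^sup>\<star> * n) \<noteq> 0"
    "orbit_point n \<in> gelfand_space M" "h \<in> M \<Longrightarrow> x0 (n\<^sup>\<star> * h * n) = orbit_point n h * x0 (n\<^sup>\<star> * n)"
proof -
  show nn: "n \<in> normalizers UNIV M" using n v gns_vector_zero by (auto simp: N_eq)
  have sq: "x0 (n\<^sup>\<star> * n) = complex_of_real ((norm (gns_vector n))\<^sup>2)"
    using norm_gns_vector[of n] N_square(1)[OF n] by (simp add: E_fix)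
  show dom: "x0 \<in> alpha_dom M n" using x0 v by (simp add: alpha_dom_def sq)
  show "x0 (n\<^sup>\<star> * n) \<noteq> 0" using v by (simp add: sq)
  have "orbit_point n \<in> gelfand_space M \<and> (\<forall>h\<in>M. x0 (n\<^sup>\<star> * h * n) = orbit_point n h * x0 (n\<^sup>\<star> * n))"
    using alpha_unique[OF M_subalgebra M_abelian M_one nn dom, of "orbit_point n"] by (simp add: orbit_point_def)
  thus "orbit_point n \<in> gelfand_space M" "h \<in> M \<Longrightarrow> x0 (n\<^sup>\<star> * h * n) = orbit_point n h * x0 (n\<^sup>\<star> * n)" by auto
qed

text \<open>The element \<open>k = h - \<alpha>\<^sub>n(x\<^sub>0)(h)\<close> vanishes at \<open>\<alpha>\<^sub>n(x\<^sub>0)\<close>, so \<open>\<parallel>\<pi> (k n) \<xi>\<parallel>\<^sup>2 = (n\<^sup>\<star> k\<^sup>\<star> k n)(x\<^sub>0) = 0\<close>.\<close>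
lemma gns_vector_eigenvector:
  assumes n: "n \<in> N" and v: "gns_vector n \<noteq> 0" and h: "h \<in> M"
  shows "bop_apply (\<pi> h) (gns_vector n) = orbit_point n h *\<^sub>C gns_vector n"
proof -
  note facts = gns_vector_nonzero[OF n v]
  define k where "k = h - orbit_point n h *\<^sub>C 1"
  have k: "k \<in> M" using h by (simp add: k_def M_closed)
  have one: "orbit_point n 1 = 1" using facts(3) facts(5)[OF M_one] by simp
  have "orbit_point n h = orbit_point n (k + orbit_point n h *\<^sub>C 1)" by (simp add: k_def)
  also have "\<dots> = orbit_point n k + orbit_point n h * orbit_point n 1"
    using facts(4) k by (simp add: gelfand_space_def M_closed)
  finally have k0: "orbit_point n k = 0" by (simp add: one)
  have "complex_of_real ((norm (gns_vector (k * n)))\<^sup>2) = x0 (E (n\<^sup>\<star> * (k\<^sup>\<star> * k) * n))"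
    using norm_gns_vector[of "k * n"] by (simp add: star_mult mult.assoc)
  also have "\<dots> = orbit_point n (k\<^sup>\<star> * k) * x0 (n\<^sup>\<star> * n)"
    using k n by (simp add: E_fix N_conj M_closed facts(5))
  also have "orbit_point n (k\<^sup>\<star> * k) = orbit_point n (k\<^sup>\<star>) * orbit_point n k"
    using facts(4) k by (simp add: gelfand_space_def M_closed)
  finally have "gns_vector (k * n) = 0" by (simp add: k0)
  thus ?thesis
    by (simp add: k_def left_diff_distrib gns_vector_diff mult_scaleC_left gns_vector_scaleC gns_vector_mult[of h n])
qed

lemma orbit_point_star:
  assumes n: "n \<in> N" and v: "gns_vector n \<noteq> 0" and h: "h \<in> M"
  shows "cnj (orbit_point n (h\<^sup>\<star>)) = orbit_point n h"
proof -
  have "orbit_point n h * cinner (gns_vector n) (gns_vector n) = cinner (bop_apply (\<pi> h) (gns_vector n)) (gns_vector n)"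
    by (simp add: gns_vector_eigenvector assms cinner_scaleC_left)
  also have "\<dots> = cinner (gns_vector n) (bop_apply (\<pi> (h\<^sup>\<star>)) (gns_vector n))" by (simp add: cinner_star rep_star)
  also have "\<dots> = cnj (orbit_point n (h\<^sup>\<star>)) * cinner (gns_vector n) (gns_vector n)"
    by (simp add: gns_vector_eigenvector assms cinner_scaleC_right M_star)
  finally show ?thesis using v by (simp add: cinner_self)
qed

text \<open>This is where trivial isotropy enters. The normalizer \<open>k = m\<^sup>\<star> n\<close> moves \<open>x\<^sub>0\<close> along \<open>\<alpha>\<^sub>n\<close> to the common
point and back along \<open>\<alpha>\<^sub>m\<^sup>-\<^sup>1\<close>, so it fixes \<open>x\<^sub>0\<close> and \<open>e = E k\<close> does not vanish there. Then
\<open>e\<^sup>\<star> k = e\<^sup>\<star> e\<close> yields \<open>\<pi> k \<xi> = e(x\<^sub>0) \<xi>\<close>; applying \<open>\<pi> m\<close> gives \<open>\<pi> m \<xi>\<close> up to this scalar on the right and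
\<open>\<pi> (m m\<^sup>\<star>) \<pi> n \<xi>\<close> on the left, which is a nonzero multiple of \<open>\<pi> n \<xi>\<close>.\<close>
lemma eigenvector_unique:
  assumes n: "n \<in> N" "gns_vector n \<noteq> 0" and m: "m \<in> N" "gns_vector m \<noteq> 0" and eq: "orbit_point n = orbit_point m"
  shows "\<exists>c. gns_vector n = c *\<^sub>C gns_vector m"
proof -
  note fn = gns_vector_nonzero[OF n] and fm = gns_vector_nonzero[OF m]
  define k where "k = m\<^sup>\<star> * n"
  define D where "D = x0 (m\<^sup>\<star> * m) * x0 (n\<^sup>\<star> * n)"
  have D: "D \<noteq> 0" using fn(3) fm(3) by (simp add: D_def)
  have kN: "k \<in> N" unfolding k_def using n m by (intro N_mult N_star)
  have chm: "orbit_point m (m * h * m\<^sup>\<star>) = x0 h * x0 (m\<^sup>\<star> * m)" if h: "h \<in> M" for h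
  proof -
    have "orbit_point m (m * h * m\<^sup>\<star>) * x0 (m\<^sup>\<star> * m) = x0 (m\<^sup>\<star> * (m * h * m\<^sup>\<star>) * m)"
      using fm(5) N_conj m h by simp
    also have "m\<^sup>\<star> * (m * h * m\<^sup>\<star>) * m = (m\<^sup>\<star> * m) * h * (m\<^sup>\<star> * m)" by (simp add: mult.assoc)
    also have "x0 \<dots> = x0 h * x0 (m\<^sup>\<star> * m) * x0 (m\<^sup>\<star> * m)"
      using h m by (simp add: x0_mult M_mult N_square)
    finally show ?thesis using fm(3) by simp
  qed
  have kh: "x0 (k\<^sup>\<star> * h * k) = x0 h * D" if h: "h \<in> M" for h
  proof -
    have "k\<^sup>\<star> * h * k = n\<^sup>\<star> * (m * h * m\<^sup>\<star>) * n" by (simp add: k_def star_mult star_star mult.assoc)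
    thus ?thesis using fn(5)[OF N_conj(2)[OF m(1) h]] chm[OF h] by (simp add: eq D_def)
  qed
  have k1: "x0 (k\<^sup>\<star> * k) = D" using kh[OF M_one] by (simp add: x0_one)
  have vk: "gns_vector k \<noteq> 0"
    using norm_gns_vector[of k] k1 D kN by (auto simp: E_fix N_square)
  note fk = gns_vector_nonzero[OF kN vk]
  have chk: "orbit_point k = x0"
  proof
    fix h show "orbit_point k h = x0 h"
      using x0 D kh[of h] k1 by (cases "h \<in> M") (auto simp: orbit_point_def alpha_def gelfand_space_def extensional_def)
  qed
  define e where "e = E k"
  have e: "e \<in> M" by (simp add: e_def)
  have e0: "x0 e \<noteq> 0" using isotropy fk(1,2) chk by (auto simp: nontrivial_isotropy_def orbit_point_def e_def)
  have v1: "gns_vector 1 = \<xi>" by (simp add: gns_vector_def unit bop_apply_one)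
  have "gns_vector 1 \<noteq> 0" using norm_gns_vector[of 1] by (auto simp: E_fix M_one x0_one)
  moreover have "orbit_point 1 = x0"
  proof
    fix h show "orbit_point 1 h = x0 h"
      using x0 by (cases "h \<in> M") (auto simp: orbit_point_def alpha_def x0_one gelfand_space_def extensional_def)
  qed
  ultimately have vh: "gns_vector h = x0 h *\<^sub>C \<xi>" if "h \<in> M" for h
    using gns_vector_eigenvector[OF N_one _ that] gns_vector_mult[of h 1] by (simp add: v1)
  have es: "x0 (e\<^sup>\<star>) \<noteq> 0" using orbit_point_star[OF kN vk e] e0 chk by auto
  have "x0 (e\<^sup>\<star>) *\<^sub>C gns_vector k = gns_vector (e\<^sup>\<star> * k)"
    using gns_vector_eigenvector[OF kN vk M_star[OF e]] by (simp add: chk gns_vector_mult)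
  also have "\<dots> = gns_vector (e\<^sup>\<star> * e)" using E_normalizer_absorb[OF kN] by (simp add: e_def)
  also have "\<dots> = x0 (e\<^sup>\<star>) *\<^sub>C x0 e *\<^sub>C \<xi>" using e by (simp add: vh x0_mult M_closed scaleC_scaleC)
  finally have vk': "gns_vector k = x0 e *\<^sub>C \<xi>" using scaleC_cancel es by blast
  have "x0 (m\<^sup>\<star> * m) *\<^sub>C gns_vector n = gns_vector (m * 1 * m\<^sup>\<star> * n)"
    using gns_vector_eigenvector[OF n N_conj(2)[OF m(1) M_one]] chm[OF M_one]
    by (simp add: eq x0_one gns_vector_mult)
  also have "\<dots> = bop_apply (\<pi> m) (gns_vector k)" by (simp add: k_def mult.assoc gns_vector_mult)
  also have "\<dots> = x0 e *\<^sub>C gns_vector m" by (simp add: vk' bop_apply_scaleC gns_vector_def[of m])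
  finally have "gns_vector n = (x0 e / x0 (m\<^sup>\<star> * m)) *\<^sub>C gns_vector m"
    by - (rule scaleC_cancel[OF _ fm(3)], simp add: scaleC_scaleC fm(3))
  thus ?thesis ..
qed

text \<open>Between eigenvectors for different points the matrix entries of \<open>T\<close> vanish since \<open>M\<close> separates the two
points; between eigenvectors for the same point the entry is a multiple of a diagonal one.\<close>
lemma commuting_zero:
  assumes comm: "\<And>h. h \<in> M \<Longrightarrow> T * \<pi> h = \<pi> h * T"
    and diag: "\<And>n. n \<in> N \<Longrightarrow> cinner (bop_apply T (gns_vector n)) (gns_vector n) = 0"
  shows "T = 0"
proof (rule operator_zero)
  interpret T: bounded_linear "bop_apply T" by (rule bounded_linear_bop_apply)
  fix n assume n: "n \<in> N"
  have entry: "cinner (bop_apply T (gns_vector n)) (gns_vector m) = 0" if m: "m \<in> N" for m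
  proof (cases "gns_vector n = 0 \<or> gns_vector m = 0")
    case True thus ?thesis by (auto simp: T.zero)
  next
    case False
    hence vn: "gns_vector n \<noteq> 0" and vm: "gns_vector m \<noteq> 0" by auto
    show ?thesis
    proof (cases "orbit_point n = orbit_point m")
      case True
      obtain c where "gns_vector n = c *\<^sub>C gns_vector m" using eigenvector_unique[OF n vn m vm True] by blast
      thus ?thesis using diag[OF m] by (simp add: bop_apply_scaleC cinner_scaleC_left)
    next
      case False
      have "\<exists>h\<in>M. orbit_point n h \<noteq> orbit_point m h"
      proof (rule ccontr)
        assume "\<not> ?thesis"
        hence "orbit_point n = orbit_point m" unfolding orbit_point_def alpha_def by (intro restrict_ext) auto
        thus False using False by simp
      qed
      then obtain h where h: "h \<in> M" "orbit_point n h \<noteq> orbit_point m h" by blast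
      have "orbit_point n h * cinner (bop_apply T (gns_vector n)) (gns_vector m) = cinner (bop_apply (T * \<pi> h) (gns_vector n)) (gns_vector m)"
        using h by (simp add: bop_apply_mult gns_vector_eigenvector n vn bop_apply_scaleC cinner_scaleC_left)
      also have "\<dots> = cinner (bop_apply T (gns_vector n)) (bop_apply (\<pi> (h\<^sup>\<star>)) (gns_vector m))"
        using h by (simp add: comm bop_apply_mult cinner_star rep_star)
      also have "\<dots> = orbit_point m h * cinner (bop_apply T (gns_vector n)) (gns_vector m)"
        using h by (simp add: gns_vector_eigenvector m vm cinner_scaleC_right M_star orbit_point_star)
      finally show ?thesis using h by simp
    qed
  qed
  have "cinner (bop_apply T (gns_vector n)) (bop_apply T (gns_vector n)) = 0"
    by (rule eq_0_if_eq_0_on_normalizer_vectors)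
       (simp_all add: linear_continuous_on bounded_linear_cinner_right cinner_add_right entry)
  thus "bop_apply T (gns_vector n) = 0" by (simp add: cinner_self)
qed

lemma rep_M_commute: "h \<in> M \<Longrightarrow> k \<in> M \<Longrightarrow> \<pi> h * \<pi> k = \<pi> k * \<pi> h"
  by (simp add: rep_mult[symmetric] M_commute)

lemma diagonal_E:
  assumes "n \<in> N"
  shows "cinner (bop_apply (\<pi> (E a)) (gns_vector n)) (gns_vector n) = cinner (bop_apply (\<pi> a) (gns_vector n)) (gns_vector n)"
  by (simp add: cinner_gns_vector E_covariant assms E_fix)

text \<open>Both sides commute with \<open>\<pi> M\<close> and have the same diagonal.\<close>
lemma rep_commutant:
  assumes "\<And>h. h \<in> M \<Longrightarrow> \<pi> a * \<pi> h = \<pi> h * \<pi> a"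
  shows "\<pi> a = \<pi> (E a)"
proof -
  have "\<pi> a - \<pi> (E a) = 0"
    by (rule commuting_zero)
       (simp_all add: left_diff_distrib right_diff_distrib assms rep_M_commute bop_apply_diff
         cinner_diff_left diagonal_E)
  thus ?thesis by simp
qed

lemma rep_E_kernel:
  assumes "\<pi> a = \<pi> b"
  shows "\<pi> (E a) = \<pi> (E b)"
proof -
  have "\<pi> (E (a - b)) = 0"
  proof (rule commuting_zero)
    show "\<pi> (E (a - b)) * \<pi> h = \<pi> h * \<pi> (E (a - b))" if "h \<in> M" for h
      using that by (simp add: rep_M_commute)
    show "cinner (bop_apply (\<pi> (E (a - b))) (gns_vector n)) (gns_vector n) = 0" if "n \<in> N" for n
      unfolding diagonal_E[OF that] by (simp add: rep_diff assms bop_apply_zero)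
  qed
  thus ?thesis by (simp add: E_diff rep_diff)
qed

lemma rep_E_faithful:
  assumes "\<pi> (E (a\<^sup>\<star> * a)) = 0"
  shows "\<pi> a = 0"
proof (rule operator_zero)
  fix n assume n: "n \<in> N"
  have "cinner (bop_apply (\<pi> (a\<^sup>\<star> * a)) (gns_vector n)) (gns_vector n) = 0"
    unfolding diagonal_E[OF n, symmetric] assms by (simp add: bop_apply_zero)
  hence "cinner (bop_apply (\<pi> a) (gns_vector n)) (bop_apply (\<pi> a) (gns_vector n)) = 0"
    by (simp add: rep_mult rep_star bop_apply_mult cinner_star_left)
  thus "bop_apply (\<pi> a) (gns_vector n) = 0" by (simp add: cinner_self)
qed

text \<open>The Schwarz inequality for \<open>E\<close>: \<open>E(a\<^sup>\<star> a) - E(a)\<^sup>\<star> E(a) = E((a - E a)\<^sup>\<star> (a - E a))\<close> is positive.\<close>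
lemma rep_E_schwarz: "(norm (\<pi> (E a)))\<^sup>2 \<le> norm (\<pi> (E (a\<^sup>\<star> * a)))"
proof -
  define t where "t = norm (\<pi> (E (a\<^sup>\<star> * a)))"
  obtain b where b: "E ((a - E a)\<^sup>\<star> * (a - E a)) = b\<^sup>\<star> * b" using E_positive by blast
  have "E ((a - E a)\<^sup>\<star> * (a - E a)) = E (a\<^sup>\<star> * a) - (E a)\<^sup>\<star> * E a"
    by (simp add: star_diff algebra_simps E_diff E_add E_mult_left E_mult_right E_star M_star E_fix)
  hence eq: "E (a\<^sup>\<star> * a) = (E a)\<^sup>\<star> * E a + b\<^sup>\<star> * b" using b by (simp add: algebra_simps)
  have "norm (\<pi> (E a)) \<le> sqrt t"
  proof (rule norm_bop_leI)
    fix w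
    have "cinner (bop_apply (\<pi> (E (a\<^sup>\<star> * a))) w) w
        = complex_of_real ((norm (bop_apply (\<pi> (E a)) w))\<^sup>2 + (norm (bop_apply (\<pi> b) w))\<^sup>2)"
      by (simp add: eq rep_add rep_mult rep_star bop_apply_add bop_apply_mult cinner_add_left
          cinner_star_left cinner_self)
    hence "(norm (bop_apply (\<pi> (E a)) w))\<^sup>2 + (norm (bop_apply (\<pi> b) w))\<^sup>2
        = cmod (cinner (bop_apply (\<pi> (E (a\<^sup>\<star> * a))) w) w)" by (simp del: of_real_add)
    also have "\<dots> \<le> norm (bop_apply (\<pi> (E (a\<^sup>\<star> * a))) w) * norm w" by (rule cinner_cauchy_schwarz)
    also have "\<dots> \<le> t * norm w * norm w" unfolding t_def by (intro mult_right_mono norm_bop_apply) simp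
    finally have "(norm (bop_apply (\<pi> (E a)) w))\<^sup>2 \<le> t * norm w * norm w"
      using zero_le_power2[of "norm (bop_apply (\<pi> b) w)"] by linarith
    also have "\<dots> = (sqrt t * norm w)\<^sup>2" by (simp add: t_def power_mult_distrib power2_eq_square)
    finally show "norm (bop_apply (\<pi> (E a)) w) \<le> sqrt t * norm w"
      by (rule power2_le_imp_le) (simp add: t_def)
  qed (simp add: t_def)
  hence "(norm (\<pi> (E a)))\<^sup>2 \<le> (sqrt t)\<^sup>2" by (intro power_mono) simp_all
  thus ?thesis by (simp add: t_def)
qed

text \<open>Choosing a preimage with \<open>bounded_lift\<close> bounds \<open>\<parallel>\<pi> (E a)\<parallel>\<close> by \<open>50 \<parallel>\<pi> a\<parallel>\<close> at first. For self-adjoint \<open>c\<close> the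
Schwarz inequality gives \<open>\<parallel>\<pi> (E c)\<parallel>\<^sup>2 \<le> \<parallel>\<pi> (E (c\<^sup>2))\<parallel>\<close>, and iterating it removes the constant. The general
case follows by applying this to \<open>a\<^sup>\<star> a\<close>.\<close>
lemma rep_E_contractive: "norm (\<pi> (E a)) \<le> norm (\<pi> a)"
proof -
  have sa: "norm (\<pi> (E c)) \<le> norm (\<pi> c)" if c: "c\<^sup>\<star> = c" for c
  proof (rule power_two_power_le_imp_le[where K = 50])
    fix j
    have cj: "(c ^ i)\<^sup>\<star> = c ^ i" for i by (induction i) (simp_all add: star_mult c power_commutes)
    have "norm (\<pi> (E c)) ^ (2 ^ j) \<le> norm (\<pi> (E (c ^ (2 ^ j))))"
    proof (induction j)
      case (Suc j)
      have "norm (\<pi> (E c)) ^ (2 ^ Suc j) = (norm (\<pi> (E c)) ^ (2 ^ j))\<^sup>2"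
        by (simp add: power_mult[symmetric] mult.commute)
      also have "\<dots> \<le> (norm (\<pi> (E (c ^ (2 ^ j)))))\<^sup>2" using Suc by (intro power_mono) simp_all
      also have "\<dots> \<le> norm (\<pi> (E ((c ^ (2 ^ j))\<^sup>\<star> * c ^ (2 ^ j))))" by (rule rep_E_schwarz)
      also have "(c ^ (2 ^ j))\<^sup>\<star> * c ^ (2 ^ j) = c ^ (2 ^ Suc j)"
        by (simp add: cj power_add[symmetric] mult_2)
      finally show ?case .
    qed simp
    also have "\<dots> \<le> 50 * norm (\<pi> c) ^ (2 ^ j)"
    proof -
      obtain d where d: "\<pi> d = \<pi> (c ^ (2 ^ j))" "norm d \<le> 50 * norm (\<pi> (c ^ (2 ^ j)))"
        using bounded_lift[OF subsetD[OF closure_subset rangeI]] by blast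
      have "norm (\<pi> (E (c ^ (2 ^ j)))) = norm (\<pi> (E d))" using rep_E_kernel[OF d(1)] by simp
      also have "\<dots> \<le> norm d" using rep_norm[of "E d"] E_norm[of d] by linarith
      also have "\<dots> \<le> 50 * norm (\<pi> c ^ (2 ^ j))" using d(2) by (simp add: rep_power)
      also have "\<dots> \<le> 50 * norm (\<pi> c) ^ (2 ^ j)" by (intro mult_left_mono norm_power_ineq) simp
      finally show ?thesis .
    qed
    finally show "norm (\<pi> (E c)) ^ (2 ^ j) \<le> 50 * norm (\<pi> c) ^ (2 ^ j)" .
  qed simp
  have "(norm (\<pi> (E a)))\<^sup>2 \<le> norm (\<pi> (E (a\<^sup>\<star> * a)))" by (rule rep_E_schwarz)
  also have "\<dots> \<le> norm (\<pi> (a\<^sup>\<star> * a))" by (rule sa) (simp add: star_mult star_star)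
  also have "\<dots> = (norm (\<pi> a))\<^sup>2" by (simp add: rep_mult rep_star cstar_identity)
  finally show ?thesis by (rule power2_le_imp_le) simp
qed

text \<open>Besides maximality this shows that \<open>\<pi> M\<close> is closed, as commutants are.\<close>
lemma rep_M_eq: "\<pi> ` M = range \<pi> \<inter> commutant (\<pi> ` M)"
proof (intro equalityI subsetI)
  fix T assume "T \<in> \<pi> ` M"
  thus "T \<in> range \<pi> \<inter> commutant (\<pi> ` M)" by (auto simp: commutant_def rep_M_commute)
next
  fix T assume T: "T \<in> range \<pi> \<inter> commutant (\<pi> ` M)"
  then obtain a where a: "T = \<pi> a" by blast
  have "\<pi> a = \<pi> (E a)" using T by (intro rep_commutant) (auto simp: a commutant_def)
  thus "T \<in> \<pi> ` M" by (simp add: a)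
qed

lemma maximal_abelian_rep: "maximal_abelian (range \<pi>) (\<pi> ` M)"
  unfolding maximal_abelian_def
proof (intro conjI allI impI)
  have "cstar_subalgebra (commutant (\<pi> ` M))"
    by (rule cstar_subalgebra_commutant) (auto simp: rep_star[symmetric] M_star)
  thus "cstar_subalgebra (\<pi> ` M)"
    using cstar_subalgebra_range by (subst rep_M_eq) (rule cstar_subalgebra_Int)
  show "\<pi> ` M \<subseteq> range \<pi>" by blast
  show "abelian (\<pi> ` M)" by (auto simp: abelian_def rep_M_commute)
  fix B assume B: "cstar_subalgebra B \<and> B \<subseteq> range \<pi> \<and> abelian B \<and> \<pi> ` M \<subseteq> B"
  hence "B \<subseteq> range \<pi> \<inter> commutant (\<pi> ` M)" by (auto simp: commutant_def abelian_def)
  thus "B = \<pi> ` M" using B rep_M_eq by blast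
qed

text \<open>The preimage of a C*-subalgebra containing the normalizers of \<open>\<pi> M\<close> is closed, additive and
contains all normalizers of \<open>M\<close>: they are mapped to normalizers or to \<open>0\<close>.\<close>
lemma regular_rep: "cstar_generated (normalizers (range \<pi>) (\<pi> ` M)) = range \<pi>"
proof
  show "cstar_generated (normalizers (range \<pi>) (\<pi> ` M)) \<subseteq> range \<pi>"
    using cstar_subalgebra_range by (auto simp: cstar_generated_def normalizers_def)
  have "\<pi> a \<in> B" if B: "cstar_subalgebra B" "normalizers (range \<pi>) (\<pi> ` M) \<subseteq> B" for a B
  proof (induction a rule: normalizer_induct)
    case 1
    have "closed (\<pi> -` B)" 
      using B by (intro continuous_closed_vimage)
        (simp_all add: cstar_subalgebra_def linear_continuous_at rep_bounded_linear)
    thus ?case by (simp add: vimage_def)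
  next
    case (2 a b) thus ?case using B by (simp add: rep_add cstar_subalgebra_def)
  next
    case (3 n)
    have "\<pi> n \<in> normalizers (range \<pi>) (\<pi> ` M)" if "\<pi> n \<noteq> 0"
      using that 3 by (auto simp: normalizers_def rep_star[symmetric] rep_mult[symmetric] N_conj)
    thus ?case using B by (cases "\<pi> n = 0") (auto simp: cstar_subalgebra_def)
  qed
  thus "range \<pi> \<subseteq> cstar_generated (normalizers (range \<pi>) (\<pi> ` M))"
    by (auto simp: cstar_generated_def)
qed

text \<open>Taking the diagonal; \<open>rep_E_kernel\<close> makes the choice of the preimage irrelevant.\<close>
definition E\<pi> :: "'h bop \<Rightarrow> 'h bop" where "E\<pi> T = \<pi> (E (SOME a. \<pi> a = T))"

lemma E\<pi>_rep: "E\<pi> (\<pi> a) = \<pi> (E a)"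
  unfolding E\<pi>_def by (rule rep_E_kernel) (rule someI[of _ a], simp)

lemma faithful_conditional_expectation_rep:
  "faithful_conditional_expectation (range \<pi>) (\<pi> ` M) E\<pi>"
proof -
  have pos: "\<exists>b\<in>range \<pi>. E\<pi> ((\<pi> a)\<^sup>\<star> * \<pi> a) = b\<^sup>\<star> * b" for a
    using E_positive[of a] E\<pi>_rep[of "a\<^sup>\<star> * a"] by (auto simp: rep_mult rep_star)
  have faithful: "\<pi> a = 0" if "E\<pi> ((\<pi> a)\<^sup>\<star> * \<pi> a) = 0" for a
    using that E\<pi>_rep[of "a\<^sup>\<star> * a"] rep_E_faithful[of a] by (simp add: rep_mult rep_star)
  show ?thesis
    unfolding faithful_conditional_expectation_def conditional_expectation_def
    using pos faithful
    by (auto simp: E\<pi>_rep rep_E_contractive E_add E_scaleC E_fix E_mult_left E_mult_right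
        simp flip: rep_add rep_scaleC rep_mult)
qed

lemma separable_rep: "\<exists>D. countable D \<and> D \<subseteq> range \<pi> \<and> range \<pi> \<subseteq> closure D"
proof -
  have "\<exists>D :: 'a set. countable D \<and> UNIV \<subseteq> closure D"
    using cartan by (simp add: cartan_pair_def)
  then obtain D :: "'a set" where D: "countable D" "UNIV \<subseteq> closure D" by blast
  have "continuous_on (closure D) \<pi>" using rep_bounded_linear by (rule linear_continuous_on)
  hence "\<pi> ` closure D \<subseteq> closure (\<pi> ` D)"
    by (rule image_closure_subset) (rule closed_closure, rule closure_subset)
  moreover have "closure D = UNIV" using D(2) by blast
  ultimately have "range \<pi> \<subseteq> closure (\<pi> ` D)" by simp
  moreover have "countable (\<pi> ` D)" using D(1) by (rule countable_image)
  ultimately show ?thesis by (meson image_mono subset_UNIV)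
qed

lemma cartan_pair_rep: "cartan_pair (range \<pi>) (\<pi> ` M)"
proof -
  have "1 \<in> \<pi> ` M" using M_one unit by (metis imageI)
  thus ?thesis
    unfolding cartan_pair_def
    using cstar_subalgebra_range separable_rep maximal_abelian_rep regular_rep
      faithful_conditional_expectation_rep by blast
qed

end

theorem corollary6:
  fixes M :: "'a::cstar_algebra set"
    and E :: "'a \<Rightarrow> 'a"
    and x0 :: "'a \<Rightarrow> complex"
    and \<pi>0 :: "'a \<Rightarrow> 'h::{chilbert_space, perfect_space} bop"
  assumes "cartan_pair UNIV M"
    and "faithful_conditional_expectation UNIV M E"
    and "x0 \<in> gelfand_space M"
    and "\<not> nontrivial_isotropy UNIV M E x0"
    and "gns_representation (\<lambda>a. x0 (E a)) \<pi>0"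
  shows "cartan_pair (range \<pi>0) (\<pi>0 ` M)"
proof -
  obtain \<xi> where rep: "star_representation \<pi>0"
    and cyc: "closure (range (\<lambda>a. bop_apply (\<pi>0 a) \<xi>)) = UNIV"
    and st: "\<And>a. cinner (bop_apply (\<pi>0 a) \<xi>) \<xi> = x0 (E a)"
    using assms(5) by (auto simp: gns_representation_def)
  \<comment> \<open>\<open>\<pi>0 1\<close> acts as the identity on the dense subspace generated by the cyclic vector\<close>
  have unit: "\<pi>0 1 = 1"
  proof (rule bop_eqI)
    fix x
    have "closed {x. bop_apply (\<pi>0 1) x = x}"
      by (intro closed_Collect_eq continuous_intros linear_continuous_on bounded_linear_bop_apply)
    moreover have "bop_apply (\<pi>0 1) (bop_apply (\<pi>0 a) \<xi>) = bop_apply (\<pi>0 a) \<xi>" for a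
      using rep by (metis star_representation_def bop_apply_mult mult_1)
    ultimately have "closure (range (\<lambda>a. bop_apply (\<pi>0 a) \<xi>)) \<subseteq> {x. bop_apply (\<pi>0 1) x = x}"
      by (intro closure_minimal) auto
    thus "bop_apply (\<pi>0 1) x = bop_apply 1 x" using cyc by (auto simp: bop_apply_one)
  qed
  interpret gns_cartan M E \<pi>0 x0 \<xi>
    using assms rep unit cyc st by unfold_locales (auto simp: faithful_conditional_expectation_def)
  show ?thesis by (rule cartan_pair_rep)
qed

end
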